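(* With the Aztec diamond notation of the context, suppose that $d_{i,j}=d_i$ for all $0\le i,j\le k-1$. Then for every Kasteleyn orientation $\varphi$ of $A_k$ there is a sign $\pm$ (independent of $\tau$) such that $$Z(A_k,a,\varphi)=\pm\sum_{\tau\in S_{k+1}}\operatorname{sgn}(\tau)\prod_{j=0}^{k}\Biggl(\prod_{0\le i<\tau(j)}(c_{i,j}-d_i)\prod_{\tau(j)<i\le k}(c_{i,j}-d_{i-1})\Biggr),$$ where $S_{k+1}$ is the group of permutations of $\{0,\dots,k\}$.
   Context: Fix $k\geq1$. Let $G^\bullet$ be the planar graph with vertices $b_r$, $\tilde b$ and $b_{i,j}$ ($0\le i\le k-1$, $0\le j\le k$), drawn with $b_{i,j}$ at $(i+1,j)$, $b_r$ to the left and $\tilde b$ to the right of everything. Its edges are the horizontal edges $e_{i,j}$ ($0\le i,j\le k$) joining $b_{i-1,j}$ and $b_{i,j}$, with $b_{-1,j}:=b_r$, $b_{k,j}:=\tilde b$, and the vertical edges $g_{i,j}$ ($0\le i,j\le k-1$) joining $b_{i,j}$ and $b_{i,j+1}$. Let $F$ be the set of edges of $G^\bullet$, with weights $a$: $c_{i,j}$ on $e_{i,j}$, $d_{i,j}$ on $g_{i,j}$. Let $B=\{b_{i,j}\}$ and $W$ the set of bounded faces of $G^\bullet$. The Aztec diamond $A_k$ is the bipartite planar graph on $W\sqcup B$ with $w\sim b$ iff $b$ lies on $\partial w$; $f(w,b)\in F$ (resp. $f(b,w)$) is the edge of $\partial w$ incident to $b$ traversed just before (resp. after) $b$ in a counterclockwise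 traversal of $\partial w$. A Kasteleyn orientation of $A_k$ is a skew-symmetric $\varphi$ from directed edges to $\{\pm1\}$ with $\prod_{wb\in\partial f}\varphi_{(w,b)}=(-1)^{\ell+1}$ for every bounded face of $A_k$ of degree $2\ell$; $Z(A_k,a,\varphi)=\sum_{\mathsf M}\prod_{wb\in\mathsf M}\varphi_{(w,b)}(a_{f(w,b)}-a_{f(b,w)})$ over perfect matchings of $A_k$. *)

theory Defs
  imports Complex_Main "HOL-Combinatorics.Combinatorics"
begin

text \<open>A simple graph drawn in the plane is recorded by its rotation system: each vertex carries the
  list of its neighbours in counterclockwise order, starting anywhere.  A dart is an edge with a
  direction, given as the pair (tail, head).  The distinguished dart has the unbounded face on
  its left.\<close>

record 'v plane_graph =
  verts :: "'v set"
  ccw :: "'v \<Rightarrow> 'v list"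
  outer_dart :: "'v \<times> 'v"

definition darts :: "('v, 'm) plane_graph_scheme \<Rightarrow> ('v \<times> 'v) set" where
  "darts G = {(u, v). u \<in> verts G \<and> v \<in> set (ccw G u)}"

text \<open>Following the boundary of the face to the left of \<open>(u, v)\<close>, one leaves \<open>v\<close> along the edge that
  comes next after \<open>u\<close> in clockwise order around \<open>v\<close>; \<open>cycle_of_list\<close> is
  the cyclic successor in a list.\<close>

definition next_dart :: "('v, 'm) plane_graph_scheme \<Rightarrow> 'v \<times> 'v \<Rightarrow> 'v \<times> 'v" where
  "next_dart G = (\<lambda>(u, v). (v, cycle_of_list (rev (ccw G v)) u))"

text \<open>A face is represented by the set of darts that have it on their left; a bounded face is
  thus traversed counterclockwise by its darts.\<close>

definition left_face :: "('v, 'm) plane_graph_scheme \<Rightarrow> 'v \<times> 'v \<Rightarrow> ('v \<times> 'v) set" where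
  "left_face G x = orbit (next_dart G) x"

definition bounded_faces :: "('v, 'm) plane_graph_scheme \<Rightarrow> ('v \<times> 'v) set set" where
  "bounded_faces G = left_face G ` darts G - {left_face G (outer_dart G)}"

definition boundary_walk :: "('v, 'm) plane_graph_scheme \<Rightarrow> ('v \<times> 'v) set \<Rightarrow> 'v list" where
  "boundary_walk G w = map (\<lambda>n. fst ((next_dart G ^^ n) (SOME x. x \<in> w))) [0..<card w]"

text \<open>The edges traversed just before and just after \<open>b\<close> when the boundary of \<open>w\<close> is traversed
  counterclockwise.  They are determined by \<open>w\<close> and \<open>b\<close> since the boundaries in question are
  simple cycles.  Edges are unordered pairs of vertices.\<close>

definition edge_before :: "('v \<times> 'v) set \<Rightarrow> 'v \<Rightarrow> 'v set" where
  "edge_before w b = (THE e. \<exists>u. (u, b) \<in> w \<and> e = {u, b})"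

definition edge_after :: "('v \<times> 'v) set \<Rightarrow> 'v \<Rightarrow> 'v set" where
  "edge_after w b = (THE e. \<exists>v. (b, v) \<in> w \<and> e = {b, v})"


section \<open>The graph \<open>G\<^sup>\<bullet>\<close>\<close>

text \<open>\<open>B_left\<close> is \<open>b\<^sub>r\<close>, \<open>B_right\<close> is the vertex written b with a tilde, and \<open>e_left i j\<close>, \<open>e_right k i j\<close>
  are the left and right endpoints of \<open>e\<^sub>i\<^sub>,\<^sub>j\<close>.\<close>

datatype vert = B_left | B_right | Bv nat nat

definition e_left :: "nat \<Rightarrow> nat \<Rightarrow> vert" where
  "e_left i j = (if i = 0 then B_left else Bv (i - 1) j)"

definition e_right :: "nat \<Rightarrow> nat \<Rightarrow> nat \<Rightarrow> vert" where
  "e_right k i j = (if i = k then B_right else Bv i j)"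

definition e_edge :: "nat \<Rightarrow> nat \<Rightarrow> nat \<Rightarrow> vert set" where
  "e_edge k i j = {e_left i j, e_right k i j}"

definition g_edge :: "nat \<Rightarrow> nat \<Rightarrow> vert set" where
  "g_edge i j = {Bv i j, Bv i (j + 1)}"

definition black_verts :: "nat \<Rightarrow> vert set" where
  "black_verts k = {Bv i j |i j. i < k \<and> j \<le> k}"

text \<open>At \<open>b\<^sub>i\<^sub>,\<^sub>j\<close> the neighbours are listed in the order east, north, west, south; the edges at
  the left vertex go from bottom to top and those at the right vertex from top to bottom.\<close>

fun gdot_ccw :: "nat \<Rightarrow> vert \<Rightarrow> vert list" where
  "gdot_ccw k (Bv i j) =
     [e_right k (i + 1) j] @ (if j < k then [Bv i (j + 1)] else []) @
     [e_left i j] @ (if 0 < j then [Bv i (j - 1)] else [])"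
| "gdot_ccw k B_left = map (e_right k 0) [0..<k + 1]"
| "gdot_ccw k B_right = map (e_left k) (rev [0..<k + 1])"

definition gdot :: "nat \<Rightarrow> vert plane_graph" where
  "gdot k = \<lparr>verts = {B_left, B_right} \<union> black_verts k, ccw = gdot_ccw k,
             outer_dart = (Bv 0 0, B_left)\<rparr>"


section \<open>The Aztec diamond\<close>

type_synonym gface = "(vert \<times> vert) set"

definition white_faces :: "nat \<Rightarrow> gface set" where
  "white_faces k = bounded_faces (gdot k)"

definition aztec_edges :: "nat \<Rightarrow> (gface \<times> vert) set" where
  "aztec_edges k = {(w, b). w \<in> white_faces k \<and> b \<in> black_verts k \<and> b \<in> fst ` w}"

datatype aztec_vert = White gface | Black vert

text \<open>\<open>A\<^sub>k\<close> is drawn with \<open>w\<close> in the interior of the corresponding face of \<open>G\<^sup>\<bullet>\<close>.  So the neighbours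
  of \<open>w\<close> appear around \<open>w\<close> in the order in which the boundary of the face visits them, and the
  neighbours of \<open>b\<close> appear around \<open>b\<close> in the order of the faces of \<open>G\<^sup>\<bullet>\<close> around \<open>b\<close>; the face to the
  left of \<open>(b, v)\<close> is the one following the edge to \<open>v\<close> counterclockwise.  The face to the left of
  \<open>(B_left, Bv 0 0)\<close> is the bounded face with \<open>e\<^sub>0\<^sub>,\<^sub>0\<close> at its bottom.\<close>

fun aztec_ccw :: "nat \<Rightarrow> aztec_vert \<Rightarrow> aztec_vert list" where
  "aztec_ccw k (White w) =
     map Black (filter (\<lambda>b. b \<in> black_verts k) (boundary_walk (gdot k) w))"
| "aztec_ccw k (Black b) =
     map White (filter (\<lambda>w. w \<in> white_faces k)
       (map (\<lambda>v. left_face (gdot k) (b, v)) (ccw (gdot k) b)))"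

definition aztec :: "nat \<Rightarrow> aztec_vert plane_graph" where
  "aztec k = \<lparr>verts = White ` white_faces k \<union> Black ` black_verts k, ccw = aztec_ccw k,
              outer_dart = (Black (Bv 0 0), White (left_face (gdot k) (B_left, Bv 0 0)))\<rparr>"

text \<open>The value of \<open>\<phi>\<close> on the edge underlying a dart, directed from white to black.\<close>

fun white_to_black :: "(aztec_vert \<times> aztec_vert \<Rightarrow> int) \<Rightarrow> aztec_vert \<times> aztec_vert \<Rightarrow> int" where
  "white_to_black \<phi> (White w, y) = \<phi> (White w, y)"
| "white_to_black \<phi> (Black b, y) = \<phi> (y, Black b)"

definition kasteleyn_orientation :: "nat \<Rightarrow> (aztec_vert \<times> aztec_vert \<Rightarrow> int) \<Rightarrow> bool" where
  "kasteleyn_orientation k \<phi> \<longleftrightarrow>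
     (\<forall>(x, y)\<in>darts (aztec k). \<phi> (x, y) \<in> {1, -1} \<and> \<phi> (y, x) = - \<phi> (x, y)) \<and>
     (\<forall>f\<in>bounded_faces (aztec k). \<forall>l. card f = 2 * l \<longrightarrow>
        (\<Prod>x\<in>f. white_to_black \<phi> x) = (-1) ^ (l + 1))"

definition aztec_perfect_matchings :: "nat \<Rightarrow> (gface \<times> vert) set set" where
  "aztec_perfect_matchings k = {M. M \<subseteq> aztec_edges k \<and>
     (\<forall>w\<in>white_faces k. \<exists>!b. (w, b) \<in> M) \<and> (\<forall>b\<in>black_verts k. \<exists>!w. (w, b) \<in> M)}"

definition aztec_Z ::
    "nat \<Rightarrow> (vert set \<Rightarrow> 'a::comm_ring_1) \<Rightarrow> (aztec_vert \<times> aztec_vert \<Rightarrow> int) \<Rightarrow> 'a" where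
  "aztec_Z k a \<phi> = (\<Sum>M\<in>aztec_perfect_matchings k. \<Prod>(w, b)\<in>M.
     of_int (\<phi> (White w, Black b)) * (a (edge_before w b) - a (edge_after w b)))"

end

theory Submission
  imports Defs
begin

text \<open>The product of the signs around every bounded face of the Aztec diamond is prescribed, so any two
  Kasteleyn orientations differ by sign changes at vertices, which multiply \<open>Z\<close> by a global sign.  Hence
  one may take a fixed orientation.  When \<open>d\<close> depends on the column only, two
  horizontally adjacent black vertices that are matched to whites of the column between them can
  exchange partners; this changes the sign and keeps the absolute weight, so such matchings
  cancel.  In a surviving matching the black vertices of row \<open>j\<close> use all columns of whites but one, \<open>\<tau>(j)\<close>.
  Counting the whites of a column shows that \<open>\<tau>\<close> is a permutation; it determines the matching, whose
  weight is the product in the formula times \<open>-1\<close> to the number of inversions of \<open>\<tau>\<close>.\<close>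

section \<open>Orbits and boundary walks of explicit cycles\<close>

text \<open>Faces are orbits of \<open>next_dart\<close>, so concrete facts about either drawing
  come from exhibiting a cyclic list that \<open>next_dart\<close> rotates by one step. The
  relations between orientations come from the quadrilaterals of \<open>aztec k\<close> around edges
  of \<open>gdot k\<close>; their number k*k + (k-1)*(k-1) is the rank of the cycle space of the
  Aztec diamond, which is why prescribing their signs leaves only vertex signs free.

  The exchange works because black (i, q) has two white neighbours in column i, in rows q and q - 1,
  and two in column i + 1. With d constant along a column of vertical edges, the two weights on
  either side agree up to sign. The reference orientation makes them equal on the left and opposite
  on the right, so exchanging partners across a white column flips exactly one sign.

  In a surviving matching a minus sign sits at row j and column c exactly when \<tau>(j) < c and the
  row that skips c lies below j; these pairs are the inversions of \<tau>.\<close>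

lemma funpow_cycle_nth:
  assumes "map f xs = rotate1 xs" "i < length xs"
  shows "(f ^^ n) (xs ! i) = xs ! ((i + n) mod length xs)"
proof (induction n)
  case 0
  then show ?case using assms by simp
next
  case (Suc n)
  let ?m = "(i + n) mod length xs"
  have "?m < length xs" using assms(2) by (intro mod_less_divisor) linarith
  then have "f (xs ! ?m) = xs ! (Suc ?m mod length xs)"
    using assms(1) by (metis nth_map nth_rotate1)
  then show ?case using Suc by (simp add: mod_Suc_eq)
qed

lemma orbit_eq_set:
  assumes "map f xs = rotate1 xs" "x \<in> set xs"
  shows "orbit f x = set xs"
proof -
  obtain i where i: "i < length xs" "x = xs ! i"
    using assms(2) by (auto simp: in_set_conv_nth)
  let ?n = "length xs"
  note pow = funpow_cycle_nth[OF assms(1) i(1)]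
  have "y \<in> orbit f x" if y: "y \<in> set xs" for y
  proof -
    obtain l where l: "l < ?n" "y = xs ! l"
      using y by (auto simp: in_set_conv_nth)
    have "(i + (?n + l - i)) mod ?n = l" using i(1) l(1) by simp
    then have "y = (f ^^ (?n + l - i)) x" "0 < ?n + l - i"
      using l i by (auto simp: pow)
    then show ?thesis unfolding orbit_altdef by blast
  qed
  moreover have "y \<in> set xs" if y: "y \<in> orbit f x" for y
  proof -
    obtain n where "y = (f ^^ n) x" using y by (auto simp: orbit_altdef)
    moreover have "(i + n) mod ?n < ?n" using i(1) by (intro mod_less_divisor) linarith
    ultimately show ?thesis using pow i by simp
  qed
  ultimately show ?thesis by blast
qed

text \<open>The walk starts at a dart picked by \<open>SOME\<close>, so only its cyclic order is
  known and the rotation stays existential. By \<open>cycle_of_list_rev_rotate\<close> it does not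
  affect \<open>next_dart\<close>.\<close>

lemma boundary_walk_rotate:
  assumes "map (next_dart G) xs = rotate1 xs" "distinct xs" "xs \<noteq> []"
  obtains n where "boundary_walk G (set xs) = rotate n (map fst xs)"
proof -
  have "(SOME x. x \<in> set xs) \<in> set xs" using assms(3) by (simp add: some_in_eq)
  then obtain i where i: "i < length xs" "(SOME x. x \<in> set xs) = xs ! i"
    by (auto simp: in_set_conv_nth)
  have "boundary_walk G (set xs) = rotate i (map fst xs)"
    using funpow_cycle_nth[OF assms(1) i(1)] i distinct_card[OF assms(2)]
    by (intro nth_equalityI) (auto simp: boundary_walk_def nth_rotate intro!: nth_map[symmetric]
        mod_less_divisor)
  then show thesis using that by blast
qed

lemma filter_rotate:
  obtains m where "filter P (rotate n xs) = rotate m (filter P xs)"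
proof -
  let ?n = "n mod length xs"
  have "filter P (rotate n xs) = filter P (drop ?n xs) @ filter P (take ?n xs)"
    by (simp add: rotate_drop_take)
  also have "\<dots> = rotate (length (filter P (take ?n xs)))
      (filter P (take ?n xs) @ filter P (drop ?n xs))"
    by (simp add: rotate_append)
  also have "filter P (take ?n xs) @ filter P (drop ?n xs) = filter P xs"
    by (simp flip: filter_append)
  finally show thesis using that by blast
qed

lemma cycle_of_list_rev_rotate:
  assumes "distinct xs"
  shows "cycle_of_list (rev (rotate n xs)) = cycle_of_list (rev xs)"
proof (induction n)
  case (Suc n)
  let ?ys = "rev (rotate1 (rotate n xs))"
  have "rev (rotate n xs) = rotate1 ?ys" by (cases "rotate n xs") auto
  moreover have "distinct ?ys" using assms by simp
  ultimately have "cycle_of_list (rev (rotate n xs)) = cycle_of_list ?ys"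
    using cycle_of_list_rotate_independent[of ?ys 1] by simp
  then show ?case using Suc by simp
qed simp

section \<open>Faces of the planar graph and of the Aztec diamond\<close>

text \<open>The white vertex \<open>(i, j)\<close> is the bounded face with bottom edge \<open>e\<^sub>i\<^sub>,\<^sub>j\<close>.  Its black
  corners are, when they exist, \<open>(i - 1, j)\<close>, \<open>(i, j)\<close>, \<open>(i, j + 1)\<close> and \<open>(i - 1, j + 1)\<close>, so that black
  \<open>(i, j)\<close> is the lower right corner of white \<open>(i, j)\<close>.\<close>

definition face_corners :: "nat \<Rightarrow> nat \<Rightarrow> nat \<Rightarrow> vert list" where
  "face_corners k i j = [e_left i j, e_right k i j] @
     (if i < k then [Bv i (Suc j)] else []) @ (if 0 < i then [Bv (i - 1) (Suc j)] else [])"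

definition face_darts :: "nat \<Rightarrow> nat \<Rightarrow> nat \<Rightarrow> (vert \<times> vert) list" where
  "face_darts k i j = zip (face_corners k i j) (rotate1 (face_corners k i j))"

definition face :: "nat \<Rightarrow> nat \<times> nat \<Rightarrow> gface" where
  "face k = (\<lambda>(i, j). set (face_darts k i j))"

lemma verts_gdot: "verts (gdot k) = {B_left, B_right} \<union> black_verts k"
  and ccw_gdot: "ccw (gdot k) = gdot_ccw k"
  and outer_gdot: "outer_dart (gdot k) = (Bv 0 0, B_left)"
  by (simp_all add: gdot_def)

text \<open>Keeping the face on the left means turning left at each vertex, and going straight on
  where the top or bottom row has no edge to the left.\<close>

lemma next_gdot_Bv:
  assumes "i < k"
  shows "0 < j \<Longrightarrow> next_dart (gdot k) (Bv i (j - Suc 0), Bv i j) = (Bv i j, e_left i j)"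
    and "next_dart (gdot k) (e_left i j, Bv i j) =
           (Bv i j, if j < k then Bv i (Suc j) else e_right k (Suc i) j)"
    and "j < k \<Longrightarrow> next_dart (gdot k) (Bv i (Suc j), Bv i j) = (Bv i j, e_right k (Suc i) j)"
    and "next_dart (gdot k) (e_right k (Suc i) j, Bv i j) =
           (Bv i j, if 0 < j then Bv i (j - 1) else e_left i j)"
  using assms
  by (auto simp: next_dart_def ccw_gdot e_left_def e_right_def transpose_def)

lemma cycle_of_list_nth:
  assumes "distinct xs" "i < length xs"
  shows "cycle_of_list xs (xs ! i) = xs ! (Suc i mod length xs)"
proof -
  have "map (cycle_of_list xs) xs = rotate1 xs"
    using cyclic_rotation[OF assms(1), of 1] by simp
  then show ?thesis using assms(2) by (metis nth_map nth_rotate1)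
qed

text \<open>This vertex has degree \<open>k + 1\<close>, so the successor is read off by position in
  the list. The second case wraps around from bottom to top, where the outer face passes.\<close>

lemma next_gdot_left:
  assumes "0 < k"
  shows "j < k \<Longrightarrow> next_dart (gdot k) (Bv 0 (Suc j), B_left) = (B_left, Bv 0 j)"
    and "next_dart (gdot k) (Bv 0 0, B_left) = (B_left, Bv 0 k)"
proof -
  let ?xs = "rev (gdot_ccw k B_left)"
  have xs: "?xs = map (\<lambda>n. Bv 0 (k - n)) [0..<Suc k]"
    using assms by (intro nth_equalityI) (auto simp: e_right_def rev_nth simp del: upt_Suc)
  have d: "distinct ?xs" unfolding xs by (auto simp: distinct_map inj_on_def simp del: upt_Suc)
  show "next_dart (gdot k) (Bv 0 (Suc j), B_left) = (B_left, Bv 0 j)" if "j < k"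
    using cycle_of_list_nth[OF d, of "k - Suc j"] that
    by (simp add: next_dart_def ccw_gdot xs nth_rotate1 del: upt_Suc gdot_ccw.simps)
  show "next_dart (gdot k) (Bv 0 0, B_left) = (B_left, Bv 0 k)"
    using cycle_of_list_nth[OF d, of k]
    by (simp add: next_dart_def ccw_gdot xs nth_rotate1 del: upt_Suc gdot_ccw.simps)
qed

lemma next_gdot_right:
  assumes "0 < k"
  shows "j < k \<Longrightarrow> next_dart (gdot k) (Bv (k - Suc 0) j, B_right) = (B_right, Bv (k - Suc 0) (Suc j))"
    and "next_dart (gdot k) (Bv (k - Suc 0) k, B_right) = (B_right, Bv (k - Suc 0) 0)"
proof -
  let ?xs = "rev (gdot_ccw k B_right)"
  have xs: "?xs = map (Bv (k - 1)) [0..<Suc k]"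
    using assms by (simp add: rev_map e_left_def del: upt_Suc)
  have d: "distinct ?xs" unfolding xs by (auto simp: distinct_map inj_on_def simp del: upt_Suc)
  show "next_dart (gdot k) (Bv (k - Suc 0) j, B_right) = (B_right, Bv (k - Suc 0) (Suc j))" if "j < k"
    using cycle_of_list_nth[OF d, of j] that
    by (simp add: next_dart_def ccw_gdot xs nth_rotate1 del: upt_Suc gdot_ccw.simps)
  show "next_dart (gdot k) (Bv (k - Suc 0) k, B_right) = (B_right, Bv (k - Suc 0) 0)"
    using cycle_of_list_nth[OF d, of k]
    by (simp add: next_dart_def ccw_gdot xs nth_rotate1 del: upt_Suc gdot_ccw.simps)
qed

text \<open>\<open>e_left\<close> and \<open>e_right\<close> absorb the two extreme vertices, so the
  triangles in columns 0 and k and the quadrilaterals between them share one description; only the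
  vertical sides need guards.\<close>

lemma face_iff:
  assumes "0 < k" "i \<le> k"
  shows "(u, v) \<in> face k (i, j) \<longleftrightarrow>
    (u, v) = (e_left i j, e_right k i j) \<or> (u, v) = (e_right k i (Suc j), e_left i (Suc j)) \<or>
    i < k \<and> (u, v) = (Bv i j, Bv i (Suc j)) \<or>
    0 < i \<and> (u, v) = (Bv (i - Suc 0) (Suc j), Bv (i - Suc 0) j)"
  using assms by (auto simp: face_def face_darts_def face_corners_def e_left_def e_right_def)

lemma next_gdot_face_darts:
  assumes "0 < k" "i \<le> k" "j < k"
  shows "map (next_dart (gdot k)) (face_darts k i j) = rotate1 (face_darts k i j)"
proof -
  note [simp] = face_darts_def face_corners_def
  consider "i = 0" | "i = k" | "0 < i" "i < k" using assms by linarith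
  then show ?thesis
  proof cases
    case 1
    then show ?thesis
      using assms next_gdot_left(1)[of k j] next_gdot_Bv(2)[of 0 k j] next_gdot_Bv(1)[of 0 k "Suc j"]
      by (simp add: e_left_def e_right_def)
  next
    case 2
    then show ?thesis
      using assms next_gdot_right(1)[of k j] next_gdot_Bv(3)[of "k - 1" k j]
        next_gdot_Bv(4)[of "k - 1" k "Suc j"]
      by (simp add: e_left_def e_right_def)
  next
    case 3
    then show ?thesis
      using assms next_gdot_Bv(1)[of i k "Suc j"] next_gdot_Bv(2)[of i k j]
        next_gdot_Bv(3)[of "i - 1" k j] next_gdot_Bv(4)[of "i - 1" k "Suc j"]
      by (simp add: e_left_def e_right_def)
  qed
qed

lemma left_face_eq_face:
  assumes "0 < k" "i \<le> k" "j < k" "x \<in> face k (i, j)"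
  shows "left_face (gdot k) x = face k (i, j)"
  using orbit_eq_set[OF next_gdot_face_darts[OF assms(1-3)]] assms(4)
  by (simp add: left_face_def face_def)

text \<open>Westward along the bottom row, then eastward along the top row: this direction keeps the
  unbounded face on the left.\<close>

definition outer_darts :: "nat \<Rightarrow> (vert \<times> vert) list" where
  "outer_darts k = map (\<lambda>n. (e_right k (k - n) 0, e_left (k - n) 0)) [0..<Suc k] @
     map (\<lambda>n. (e_left n k, e_right k n k)) [0..<Suc k]"

lemma next_gdot_outer_darts:
  assumes "0 < k"
  shows "map (next_dart (gdot k)) (outer_darts k) = rotate1 (outer_darts k)"
proof (rule nth_equalityI)
  show "length (map (next_dart (gdot k)) (outer_darts k)) = length (rotate1 (outer_darts k))"
    by simp
next
  fix n assume "n < length (map (next_dart (gdot k)) (outer_darts k))"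
  then have n: "n < Suc k + Suc k" by (simp add: outer_darts_def)
  have nth: "outer_darts k ! n = (if n \<le> k then (e_right k (k - n) 0, e_left (k - n) 0)
    else (e_left (n - Suc k) k, e_right k (n - Suc k) k))" if "n < Suc k + Suc k" for n
    using that by (auto simp: outer_darts_def nth_append simp del: upt_Suc)
  have len: "length (outer_darts k) = Suc k + Suc k" by (simp add: outer_darts_def)
  consider "n < k" | "n = k" | "k < n" "n < k + Suc k" | "n = k + Suc k" using n by linarith
  then have "next_dart (gdot k) (outer_darts k ! n) = outer_darts k ! (Suc n mod (Suc k + Suc k))"
  proof cases
    case 1
    then show ?thesis
      using next_gdot_Bv(4)[of "k - Suc n" k 0] by (auto simp: nth e_left_def e_right_def Suc_diff_Suc)
  next
    case 2
    then show ?thesis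
      using next_gdot_left(2)[OF assms] assms by (simp add: nth e_left_def e_right_def)
  next
    case 3
    then have "Suc n - Suc k = Suc (n - Suc k)" "n - Suc k < k" by auto
    with 3 show ?thesis
      using next_gdot_Bv(2)[of "n - Suc k" k k] by (simp add: nth e_left_def e_right_def)
  next
    case 4
    then show ?thesis
      using next_gdot_right(2)[OF assms] assms by (simp add: nth e_left_def e_right_def)
  qed
  then show "map (next_dart (gdot k)) (outer_darts k) ! n = rotate1 (outer_darts k) ! n"
    using n by (simp add: nth_rotate1 len)
qed

lemma outer_face_gdot:
  assumes "0 < k" "x \<in> set (outer_darts k)"
  shows "left_face (gdot k) x = set (outer_darts k)"
  using orbit_eq_set[OF next_gdot_outer_darts] assms by (simp add: left_face_def)

lemma outer_darts_iff:
  "x \<in> set (outer_darts k) \<longleftrightarrow>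
     (\<exists>i\<le>k. x = (e_right k i 0, e_left i 0) \<or> x = (e_left i k, e_right k i k))"
proof -
  have "(\<exists>n\<in>{0..<Suc k}. x = (e_right k (k - n) 0, e_left (k - n) 0)) \<longleftrightarrow>
        (\<exists>i\<le>k. x = (e_right k i 0, e_left i 0))"
    by (metis atLeastLessThan_iff diff_diff_cancel diff_le_self le0 less_Suc_eq_le)
  then show ?thesis by (auto simp: outer_darts_def image_iff less_Suc_eq_le simp del: upt_Suc)
qed

lemma outer_face_gdot':
  "0 < k \<Longrightarrow> left_face (gdot k) (outer_dart (gdot k)) = set (outer_darts k)"
  by (rule outer_face_gdot) (auto simp: outer_darts_iff outer_gdot e_left_def e_right_def intro!:
      exI[of _ 0])

text \<open>An eastward dart has the face above it on its left, a westward dart the face below; only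
  the top and bottom rows lead outside. Vertical darts always border two bounded faces.\<close>

lemma dart_cases:
  assumes "0 < k" "x \<in> darts (gdot k)"
  obtains i j where "i \<le> k" "j < k" "x \<in> face k (i, j)" | "x \<in> set (outer_darts k)"
proof -
  obtain u v where x: "x = (u, v)" by force
  note inner = that(1) and outer = that(2)
  have horiz: thesis if "i \<le> k" "j \<le> k"
    "x = (e_left i j, e_right k i j) \<or> x = (e_right k i j, e_left i j)" for i j
    using that
  proof (elim disjE)
    assume e: "x = (e_left i j, e_right k i j)"
    show thesis
    proof (cases "j < k")
      case True
      then show ?thesis using inner[of i j] \<open>i \<le> k\<close> e assms(1) by (simp add: x face_iff)
    next
      case False
      then show ?thesis using outer \<open>i \<le> k\<close> \<open>j \<le> k\<close> e by (auto simp: outer_darts_iff)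
    qed
  next
    assume e: "x = (e_right k i j, e_left i j)"
    show thesis
    proof (cases j)
      case (Suc l)
      then show ?thesis using inner[of i l] \<open>i \<le> k\<close> \<open>j \<le> k\<close> e assms(1) by (simp add: x face_iff)
    next
      case 0
      then show ?thesis using outer \<open>i \<le> k\<close> \<open>j \<le> k\<close> e by (auto simp: outer_darts_iff)
    qed
  qed
  have d: "u \<in> {B_left, B_right} \<union> black_verts k" "v \<in> set (gdot_ccw k u)"
    using assms(2) by (auto simp: x darts_def verts_gdot ccw_gdot)
  show thesis
  proof (cases u)
    case B_left
    then obtain j where "j \<le> k" "v = e_right k 0 j"
      using d by (auto simp: less_Suc_eq_le simp del: upt_Suc)
    then show ?thesis using horiz[of 0 j] B_left by (simp add: x e_left_def)
  next
    case B_right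
    then obtain j where "j \<le> k" "v = e_left k j"
      using d by (auto simp: less_Suc_eq_le simp del: upt_Suc)
    then show ?thesis using horiz[of k j] B_right by (simp add: x e_right_def)
  next
    case (Bv i j)
    then have ij: "i < k" "j \<le> k" using d by (auto simp: black_verts_def)
    consider "v = e_right k (Suc i) j" | "v = e_left i j" | "j < k" "v = Bv i (Suc j)"
      | "0 < j" "v = Bv i (j - 1)"
      using d(2) Bv by (auto split: if_splits)
    then show ?thesis
    proof cases
      case 1
      then show ?thesis using horiz[of "Suc i" j] Bv ij by (simp add: x e_left_def)
    next
      case 2
      then show ?thesis using horiz[of i j] Bv ij by (simp add: x e_right_def)
    next
      case 3
      then show ?thesis using inner[of i j] Bv ij by (simp add: x face_iff)
    next
      case 4
      then show ?thesis using inner[of "Suc i" "j - 1"] Bv ij by (simp add: x face_iff)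
    qed
  qed
qed

section \<open>Integer coordinates for the vertices and edges of the Aztec diamond\<close>

definition white_idx :: "nat \<Rightarrow> (nat \<times> nat) set" where
  "white_idx k = {0..k} \<times> {0..<k}"

definition black_idx :: "nat \<Rightarrow> (nat \<times> nat) set" where
  "black_idx k = {0..<k} \<times> {0..k}"

definition blk :: "nat \<times> nat \<Rightarrow> vert" where
  "blk = (\<lambda>(i, j). Bv i j)"

lemma black_verts_eq: "black_verts k = blk ` black_idx k"
  by (auto simp: black_verts_def blk_def black_idx_def)

lemma inj_blk: "inj blk" by (auto simp: blk_def inj_def)

lemma bottom_dart:
  assumes "0 < k" "i \<le> k"
  shows "(e_left i j, e_right k i j) \<in> face k (i, j)"
  using assms by (simp add: face_iff)

lemma face_not_outer:
  assumes "0 < k" "i \<le> k" "j < k"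
  shows "face k (i, j) \<noteq> set (outer_darts k)"
proof
  assume "face k (i, j) = set (outer_darts k)"
  \<comment> \<open>The only westward dart of an inner face is its top side, in row
    \<open>Suc j\<close>, so a westward dart in row 0 separates the faces.\<close>
  moreover have "(Bv 0 0, B_left) \<in> set (outer_darts k)"
    using assms by (auto simp: outer_darts_iff e_left_def e_right_def intro!: exI[of _ 0])
  ultimately have "(Bv 0 0, B_left) \<in> face k (i, j)" by simp
  then show False using assms by (auto simp: face_iff e_left_def e_right_def split: if_splits)
qed

lemma white_faces_eq:
  assumes "0 < k"
  shows "white_faces k = face k ` white_idx k"
proof (intro equalityI subsetI)
  fix w assume "w \<in> white_faces k"
  then obtain x where x: "x \<in> darts (gdot k)" "w = left_face (gdot k) x"
    "w \<noteq> set (outer_darts k)"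
    by (auto simp: white_faces_def bounded_faces_def outer_face_gdot'[OF assms])
  from dart_cases[OF assms x(1)] show "w \<in> face k ` white_idx k"
  proof cases
    case (1 i j)
    then show ?thesis using left_face_eq_face assms x by (auto simp: white_idx_def)
  next
    case 2
    then show ?thesis using outer_face_gdot assms x by auto
  qed
next
  fix w assume "w \<in> face k ` white_idx k"
  then obtain i j where ij: "i \<le> k" "j < k" "w = face k (i, j)" by (auto simp: white_idx_def)
  let ?x = "(e_left i j, e_right k i j)"
  have "?x \<in> darts (gdot k)"
    using assms ij by (auto simp: darts_def verts_gdot ccw_gdot black_verts_def e_left_def e_right_def
        simp del: upt_Suc)
  moreover have "left_face (gdot k) ?x = w" using left_face_eq_face[OF assms ij(1,2)] bottom_dart
      assms ij by simp
  ultimately show "w \<in> white_faces k"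
    using face_not_outer[OF assms ij(1,2)] ij
    by (auto simp: white_faces_def bounded_faces_def outer_face_gdot'[OF assms])
qed

text \<open>The only eastward dart of a face is its bottom side, which carries the index.\<close>

lemma inj_face:
  assumes "0 < k"
  shows "inj_on (face k) (white_idx k)"
proof (rule inj_onI)
  fix p q assume *: "p \<in> white_idx k" "q \<in> white_idx k" "face k p = face k q"
  obtain i j i' j' where pq: "p = (i, j)" "q = (i', j')" by force
  have "(e_left i j, e_right k i j) \<in> face k (i', j')"
    using bottom_dart[OF assms, of i j] * by (simp add: pq white_idx_def)
  then show "p = q" using * assms
    by (auto simp: pq white_idx_def face_iff e_left_def e_right_def split: if_splits)
qed

definition adj :: "nat \<times> nat \<Rightarrow> nat \<times> nat \<Rightarrow> bool" where
  "adj = (\<lambda>(i, j) (p, q). (p = i \<or> Suc p = i) \<and> (q = j \<or> q = Suc j))"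

lemma fst_face: "fst ` face k (i, j) = set (face_corners k i j)"
proof -
  have "map fst (face_darts k i j) = face_corners k i j"
    unfolding face_darts_def by (rule map_fst_zip) simp
  then show ?thesis by (metis face_def list.set_map prod.case)
qed

lemma aztec_edges_eq:
  assumes "0 < k"
  shows "aztec_edges k = {(face k w, blk b) |w b. w \<in> white_idx k \<and> b \<in> black_idx k \<and> adj w b}"
proof -
  have *: "blk b \<in> fst ` face k w \<longleftrightarrow> adj w b" if "w \<in> white_idx k" "b \<in> black_idx k" for w b
    using that assms by (cases w; cases b)
      (auto simp: fst_face face_corners_def white_idx_def black_idx_def adj_def blk_def e_left_def
          e_right_def)
  show ?thesis
    unfolding aztec_edges_def white_faces_eq[OF assms] black_verts_eq using * by blast
qed

section \<open>The rotation system of the Aztec diamond\<close>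

definition black_corners :: "nat \<Rightarrow> nat \<Rightarrow> nat \<Rightarrow> vert list" where
  "black_corners k i j = (if 0 < i then [Bv (i - 1) j] else []) @
     (if i < k then [Bv i j, Bv i (Suc j)] else []) @ (if 0 < i then [Bv (i - 1) (Suc j)] else [])"

lemma filter_face_corners:
  assumes "0 < k" "i \<le> k" "j < k"
  shows "filter (\<lambda>b. b \<in> black_verts k) (face_corners k i j) = black_corners k i j"
  using assms by (auto simp: face_corners_def black_corners_def black_verts_def e_left_def e_right_def)

lemma face_simple:
  assumes "0 < k" "i \<le> k" "j < k"
  shows "distinct (face_corners k i j)" "distinct (face_darts k i j)"
proof -
  show d: "distinct (face_corners k i j)"
    using assms by (auto simp: face_corners_def e_left_def e_right_def)
  show "distinct (face_darts k i j)"
    unfolding face_darts_def by (rule distinct_zipI1[OF d])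
qed

abbreviation white_vert :: "nat \<Rightarrow> nat \<Rightarrow> nat \<Rightarrow> aztec_vert" where
  "white_vert k i j \<equiv> White (face k (i, j))"

abbreviation black_vert :: "nat \<Rightarrow> nat \<Rightarrow> aztec_vert" where
  "black_vert i j \<equiv> Black (Bv i j)"

lemma aztec_ccw_white:
  assumes "0 < k" "i \<le> k" "j < k"
  obtains n where "aztec_ccw k (white_vert k i j) = rotate n (map Black (black_corners k i j))"
proof -
  obtain n where "boundary_walk (gdot k) (face k (i, j)) = rotate n (map fst (face_darts k i j))"
    using boundary_walk_rotate[OF next_gdot_face_darts[OF assms]] face_simple(2)[OF assms]
    by (auto simp: face_def face_darts_def face_corners_def)
  then have "boundary_walk (gdot k) (face k (i, j)) = rotate n (face_corners k i j)"
    by (simp add: face_darts_def map_fst_zip)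
  moreover obtain m where "filter (\<lambda>b. b \<in> black_verts k) (rotate n (face_corners k i j)) =
      rotate m (black_corners k i j)"
    using filter_rotate[of "\<lambda>b. b \<in> black_verts k" n "face_corners k i j"] filter_face_corners[OF
        assms] by metis
  ultimately show thesis using that[of m] by (simp add: rotate_map)
qed

lemma next_aztec_white:
  assumes "0 < k" "i \<le> k" "j < k"
  shows "next_dart (aztec k) (u, white_vert k i j) =
     (white_vert k i j, cycle_of_list (rev (map Black (black_corners k i j))) u)"
proof -
  have "distinct (map Black (black_corners k i j))"
    using distinct_filter[OF face_simple(1)[OF assms]] filter_face_corners[OF assms]
    by (metis aztec_vert.inject(2) distinct_map inj_onI)
  then show ?thesis
    using aztec_ccw_white[OF assms] cycle_of_list_rev_rotate
    by (metis (no_types, lifting) aztec_def next_dart_def plane_graph.simps(2) prod.case)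
qed

lemma next_aztec_white_simps:
  assumes "0 < k" "i \<le> k" "j < k"
  shows "0 < i \<Longrightarrow> next_dart (aztec k) (black_vert (i - 1) j, white_vert k i j) =
           (white_vert k i j, black_vert (i - 1) (Suc j))"
    and "i < k \<Longrightarrow> next_dart (aztec k) (black_vert i (Suc j), white_vert k i j) =
           (white_vert k i j, black_vert i j)"
    and "0 < i \<Longrightarrow> i < k \<Longrightarrow> next_dart (aztec k) (black_vert (i - 1) (Suc j), white_vert k i j) =
           (white_vert k i j, black_vert i (Suc j))"
    and "0 < i \<Longrightarrow> i < k \<Longrightarrow> next_dart (aztec k) (black_vert i j, white_vert k i j) =
           (white_vert k i j, black_vert (i - 1) j)"
    and "i = 0 \<Longrightarrow> next_dart (aztec k) (black_vert i j, white_vert k i j) =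
           (white_vert k i j, black_vert i (Suc j))"
  unfolding next_aztec_white[OF assms] using assms
  by (auto simp: black_corners_def transpose_def)

lemma left_face_black:
  assumes "0 < k" "i < k" "j \<le> k"
  shows "left_face (gdot k) (Bv i j, e_right k (Suc i) j) =
           (if j < k then face k (Suc i, j) else set (outer_darts k))"
    and "j < k \<Longrightarrow> left_face (gdot k) (Bv i j, Bv i (Suc j)) = face k (i, j)"
    and "left_face (gdot k) (Bv i j, e_left i j) =
           (if 0 < j then face k (i, j - 1) else set (outer_darts k))"
    and "0 < j \<Longrightarrow> left_face (gdot k) (Bv i j, Bv i (j - 1)) = face k (Suc i, j - 1)"
proof -
  have E: "Bv i j = e_left (Suc i) j" and W: "Bv i j = e_right k i j"
    using assms by (simp_all add: e_left_def e_right_def)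
  show "left_face (gdot k) (Bv i j, e_right k (Suc i) j) =
           (if j < k then face k (Suc i, j) else set (outer_darts k))"
  proof (cases "j < k")
    case True
    then show ?thesis using assms left_face_eq_face[of k "Suc i" j] by (simp add: E face_iff)
  next
    case False
    then have "(e_left (Suc i) j, e_right k (Suc i) j) \<in> set (outer_darts k)"
      using assms by (auto simp: outer_darts_iff intro!: exI[of _ "Suc i"])
    then show ?thesis using outer_face_gdot[OF assms(1)] False by (simp add: E)
  qed
  show "left_face (gdot k) (Bv i j, e_left i j) =
           (if 0 < j then face k (i, j - 1) else set (outer_darts k))"
  proof (cases "0 < j")
    case True
    then show ?thesis using assms left_face_eq_face[of k i "j - 1"] by (simp add: W face_iff)
  next
    case False
    then have "(e_right k i j, e_left i j) \<in> set (outer_darts k)"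
      using assms by (auto simp: outer_darts_iff intro!: exI[of _ i])
    then show ?thesis using outer_face_gdot[OF assms(1)] False W by simp
  qed
  show "j < k \<Longrightarrow> left_face (gdot k) (Bv i j, Bv i (Suc j)) = face k (i, j)"
    using assms by (intro left_face_eq_face) (auto simp: face_iff)
  show "0 < j \<Longrightarrow> left_face (gdot k) (Bv i j, Bv i (j - 1)) = face k (Suc i, j - 1)"
    using assms by (intro left_face_eq_face) (auto simp: face_iff)
qed

text \<open>Two of the four surrounding faces coincide with the outer face when j is 0 or k;
  filtering them out leaves a black vertex of degree two.\<close>

lemma aztec_ccw_black:
  assumes "0 < k" "i < k" "j \<le> k"
  shows "aztec_ccw k (black_vert i j) =
    (if j < k then [white_vert k (Suc i) j, white_vert k i j] else []) @
    (if 0 < j then [white_vert k i (j - 1), white_vert k (Suc i) (j - 1)] else [])"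
proof -
  have inner: "face k (p, q) \<in> white_faces k" if "p \<le> k" "q < k" for p q
    using that by (simp add: white_faces_eq[OF assms(1)] white_idx_def)
  have outer: "set (outer_darts k) \<notin> white_faces k"
    by (simp add: white_faces_def bounded_faces_def outer_face_gdot'[OF assms(1)])
  consider "j = 0" | "j = k" | "0 < j" "j < k" using assms by linarith
  then show ?thesis
    by cases (use assms inner outer left_face_black[OF assms] in \<open>simp_all add: ccw_gdot\<close>)
qed

lemma face_eq_iff:
  assumes "0 < k" "i \<le> k" "j < k" "i' \<le> k" "j' < k"
  shows "face k (i, j) = face k (i', j') \<longleftrightarrow> i = i' \<and> j = j'"
  using inj_on_eq_iff[OF inj_face[OF assms(1)], of "(i, j)" "(i', j')"] assms by (simp add: white_idx_def)

lemma next_aztec_black_simps: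
  assumes "0 < k" "i < k" "j \<le> k"
  shows "j < k \<Longrightarrow> next_dart (aztec k) (white_vert k (Suc i) j, black_vert i (Suc j)) =
           (black_vert i (Suc j), white_vert k i j)"
    and "j < k \<Longrightarrow> next_dart (aztec k) (white_vert k i j, black_vert i j) =
           (black_vert i j, white_vert k (Suc i) j)"
    and "Suc j < k \<Longrightarrow> next_dart (aztec k) (white_vert k i j, black_vert i (Suc j)) =
           (black_vert i (Suc j), white_vert k i (Suc j))"
    and "Suc j < k \<Longrightarrow> next_dart (aztec k) (white_vert k (Suc i) (Suc j), black_vert i (Suc j)) =
           (black_vert i (Suc j), white_vert k (Suc i) j)"
proof -
  have step: "next_dart (aztec k) (u, black_vert i j') =
      (black_vert i j', cycle_of_list (rev (aztec_ccw k (black_vert i j'))) u)" for u j'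
    by (simp add: next_dart_def aztec_def)
  show "next_dart (aztec k) (white_vert k (Suc i) j, black_vert i (Suc j)) =
           (black_vert i (Suc j), white_vert k i j)" if "j < k"
    using that assms unfolding step
    by (cases "Suc j < k") (simp_all add: aztec_ccw_black face_eq_iff transpose_def del: aztec_ccw.simps)
  show "next_dart (aztec k) (white_vert k i j, black_vert i j) =
           (black_vert i j, white_vert k (Suc i) j)" if "j < k"
    using that assms unfolding step
    by (cases j) (simp_all add: aztec_ccw_black face_eq_iff transpose_def del: aztec_ccw.simps)
  show "next_dart (aztec k) (white_vert k i j, black_vert i (Suc j)) =
           (black_vert i (Suc j), white_vert k i (Suc j))" if "Suc j < k"
    using that assms unfolding step
    by (simp add: aztec_ccw_black face_eq_iff transpose_def del: aztec_ccw.simps)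
  show "next_dart (aztec k) (white_vert k (Suc i) (Suc j), black_vert i (Suc j)) =
           (black_vert i (Suc j), white_vert k (Suc i) j)" if "Suc j < k"
    using that assms unfolding step
    by (simp add: aztec_ccw_black face_eq_iff transpose_def del: aztec_ccw.simps)
qed

section \<open>Quadrilateral faces and the Kasteleyn condition\<close>

definition g_face :: "nat \<Rightarrow> nat \<Rightarrow> nat \<Rightarrow> (aztec_vert \<times> aztec_vert) list" where
  "g_face k i j = [(black_vert i j, white_vert k (Suc i) j), (white_vert k (Suc i) j, black_vert i (Suc j)),
     (black_vert i (Suc j), white_vert k i j), (white_vert k i j, black_vert i j)]"

text \<open>The quadrilateral around the horizontal edge \<open>e_edge k (Suc i) (Suc j)\<close>,
  just as \<open>g_face k i j\<close> is the one around \<open>g_edge i j\<close>. The shift keeps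
  both ends of the edge black and both sides bounded.\<close>

definition e_face :: "nat \<Rightarrow> nat \<Rightarrow> nat \<Rightarrow> (aztec_vert \<times> aztec_vert) list" where
  "e_face k i j =
    [(white_vert k (Suc i) j, black_vert (Suc i) (Suc j)),
     (black_vert (Suc i) (Suc j), white_vert k (Suc i) (Suc j)),
     (white_vert k (Suc i) (Suc j), black_vert i (Suc j)), (black_vert i (Suc j), white_vert k (Suc i) j)]"

lemma next_g_face:
  assumes "i < k" "j < k"
  shows "map (next_dart (aztec k)) (g_face k i j) = rotate1 (g_face k i j)"
  using assms next_aztec_white_simps(1)[of k "Suc i" j] next_aztec_white_simps(2)[of k i j]
    next_aztec_black_simps(1)[of k i j] next_aztec_black_simps(2)[of k i j]
  by (simp add: g_face_def)

lemma next_e_face: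
  assumes "Suc i < k" "Suc j < k"
  shows "map (next_dart (aztec k)) (e_face k i j) = rotate1 (e_face k i j)"
  using assms next_aztec_white_simps(3)[of k "Suc i" j] next_aztec_white_simps(4)[of k "Suc i" "Suc j"]
    next_aztec_black_simps(3)[of k "Suc i" j] next_aztec_black_simps(4)[of k i j]
  by (simp add: e_face_def)

text \<open>A dart to tell the outer face apart. An orbit consists of positive iterates, so the
  successor of the outer dart is the member available at once. The quadrilaterals miss it, since
  they traverse that edge from black to white.\<close>

lemma outer_face_aztec:
  assumes "0 < k"
  shows "(white_vert k 0 0, black_vert 0 (Suc 0)) \<in> left_face (aztec k) (outer_dart (aztec k))"
proof -
  have "left_face (gdot k) (B_left, Bv 0 0) = face k (0, 0)"
    using assms by (intro left_face_eq_face) (simp_all add: face_iff e_left_def e_right_def)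
  then have "next_dart (aztec k) (outer_dart (aztec k)) = (white_vert k 0 0, black_vert 0 (Suc 0))"
    using next_aztec_white_simps(5)[of k 0 0] assms by (simp add: aztec_def)
  then show ?thesis unfolding left_face_def by (metis orbit.base)
qed

lemma in_darts_aztec:
  assumes "0 < k" "i \<le> k" "j < k" "p < k" "q \<le> k" "adj (i, j) (p, q)"
  shows "(white_vert k i j, black_vert p q) \<in> darts (aztec k)"
proof -
  have "black_vert p q \<in> set (aztec_ccw k (white_vert k i j))"
  proof -
    have "black_vert p q \<in> set (map Black (black_corners k i j))"
      using assms by (auto simp: black_corners_def adj_def)
    then show ?thesis using aztec_ccw_white[OF assms(1-3)] by (metis set_rotate)
  qed
  then show ?thesis
    using assms by (simp add: darts_def aztec_def white_faces_eq white_idx_def)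
qed

lemma g_face_bounded:
  assumes "i < k" "j < k"
  shows "set (g_face k i j) \<in> bounded_faces (aztec k)"
proof -
  let ?x = "(white_vert k i j, black_vert i j)"
  have "set (g_face k i j) = left_face (aztec k) ?x"
    using orbit_eq_set[OF next_g_face[OF assms]] by (simp add: left_face_def g_face_def)
  moreover have "?x \<in> darts (aztec k)" using assms by (intro in_darts_aztec) (auto simp: adj_def)
  moreover have "(white_vert k 0 0, black_vert 0 (Suc 0)) \<notin> set (g_face k i j)"
    using assms by (auto simp: g_face_def face_eq_iff)
  ultimately show ?thesis
    using outer_face_aztec[of k] assms by (auto simp: bounded_faces_def)
qed

lemma e_face_bounded:
  assumes "Suc i < k" "Suc j < k"
  shows "set (e_face k i j) \<in> bounded_faces (aztec k)"
proof -
  let ?x = "(white_vert k (Suc i) j, black_vert (Suc i) (Suc j))"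
  have "set (e_face k i j) = left_face (aztec k) ?x"
    using orbit_eq_set[OF next_e_face[OF assms]] by (simp add: left_face_def e_face_def)
  moreover have "?x \<in> darts (aztec k)" using assms by (intro in_darts_aztec) (auto simp: adj_def)
  moreover have "(white_vert k 0 0, black_vert 0 (Suc 0)) \<notin> set (e_face k i j)"
    using assms by (auto simp: e_face_def face_eq_iff)
  ultimately show ?thesis
    using outer_face_aztec[of k] assms by (auto simp: bounded_faces_def)
qed

definition edge_sign :: "nat \<Rightarrow> (aztec_vert \<times> aztec_vert \<Rightarrow> int) \<Rightarrow> nat \<times> nat \<Rightarrow> nat \<times> nat \<Rightarrow> int" where
  "edge_sign k \<phi> w b = \<phi> (White (face k w), Black (blk b))"

lemma kasteleyn_edge_sign:
  assumes "kasteleyn_orientation k \<phi>"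
  shows "w \<in> white_idx k \<Longrightarrow> b \<in> black_idx k \<Longrightarrow> adj w b \<Longrightarrow> edge_sign k \<phi> w b \<in> {1, - 1}"
    and "i < k \<Longrightarrow> j < k \<Longrightarrow> edge_sign k \<phi> (Suc i, j) (i, j) * edge_sign k \<phi> (Suc i, j) (i, Suc j) *
      edge_sign k \<phi> (i, j) (i, j) * edge_sign k \<phi> (i, j) (i, Suc j) = - 1"
    and "Suc i < k \<Longrightarrow> Suc j < k \<Longrightarrow>
      edge_sign k \<phi> (Suc i, j) (Suc i, Suc j) * edge_sign k \<phi> (Suc i, Suc j) (Suc i, Suc j) *
      edge_sign k \<phi> (Suc i, j) (i, Suc j) * edge_sign k \<phi> (Suc i, Suc j) (i, Suc j) = - 1"
proof -
  have four: "prod_list (map (white_to_black \<phi>) xs) = - 1"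
    if "set xs \<in> bounded_faces (aztec k)" "distinct xs" "length xs = 4" for xs
  proof -
    \<comment> \<open>Degree four means l = 2, whence the prescribed product is (-1)^3.\<close>
    have "card (set xs) = 2 * 2" using that by (simp add: distinct_card)
    then have "(\<Prod>x\<in>set xs. white_to_black \<phi> x) = (- 1) ^ (2 + 1)"
      using assms that(1) unfolding kasteleyn_orientation_def by blast
    then show ?thesis using that(2) by (simp add: prod.distinct_set_conv_list)
  qed
  show "edge_sign k \<phi> w b \<in> {1, - 1}" if "w \<in> white_idx k" "b \<in> black_idx k" "adj w b"
  proof -
    obtain i j p q where wb: "w = (i, j)" "b = (p, q)" by force
    have "(white_vert k i j, black_vert p q) \<in> darts (aztec k)"
      using that by (intro in_darts_aztec) (auto simp: wb white_idx_def black_idx_def)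
    then show ?thesis using assms by (auto simp: kasteleyn_orientation_def edge_sign_def wb blk_def)
  qed
  show "edge_sign k \<phi> (Suc i, j) (i, j) * edge_sign k \<phi> (Suc i, j) (i, Suc j) *
      edge_sign k \<phi> (i, j) (i, j) * edge_sign k \<phi> (i, j) (i, Suc j) = - 1" if "i < k" "j < k"
    using four[OF g_face_bounded[OF that]] that
    by (simp add: g_face_def edge_sign_def blk_def face_eq_iff ac_simps)
  show "edge_sign k \<phi> (Suc i, j) (Suc i, Suc j) * edge_sign k \<phi> (Suc i, Suc j) (Suc i, Suc j) *
      edge_sign k \<phi> (Suc i, j) (i, Suc j) * edge_sign k \<phi> (Suc i, Suc j) (i, Suc j) = - 1"
    if "Suc i < k" "Suc j < k"
    using four[OF e_face_bounded[OF that]] that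
    by (simp add: e_face_def edge_sign_def blk_def face_eq_iff ac_simps)
qed

text \<open>Counterclockwise, the sides come in the order bottom, right, top, left, and exactly one
  dart enters and one leaves each corner.\<close>

lemma edges_around_corner:
  assumes "0 < k" "i \<le> k" "j < k"
  shows "i < k \<Longrightarrow> edge_before (face k (i, j)) (Bv i j) = e_edge k i j"
    and "i < k \<Longrightarrow> edge_after (face k (i, j)) (Bv i j) = g_edge i j"
    and "i < k \<Longrightarrow> edge_before (face k (i, j)) (Bv i (Suc j)) = g_edge i j"
    and "i < k \<Longrightarrow> edge_after (face k (i, j)) (Bv i (Suc j)) = e_edge k i (Suc j)"
    and "0 < i \<Longrightarrow> edge_before (face k (i, j)) (Bv (i - 1) (Suc j)) = e_edge k i (Suc j)"
    and "0 < i \<Longrightarrow> edge_after (face k (i, j)) (Bv (i - 1) (Suc j)) = g_edge (i - 1) j"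
    and "0 < i \<Longrightarrow> edge_before (face k (i, j)) (Bv (i - 1) j) = g_edge (i - 1) j"
    and "0 < i \<Longrightarrow> edge_after (face k (i, j)) (Bv (i - 1) j) = e_edge k i j"
  using assms unfolding edge_before_def edge_after_def
  by (auto simp: face_iff e_edge_def g_edge_def e_left_def e_right_def intro!: the_equality)

section \<open>Signs and inversions\<close>

definition order_sign :: "('b::linorder) \<Rightarrow> 'b \<Rightarrow> int" where
  "order_sign x y = (if x < y then 1 else - 1)"

text \<open>Both products run over the unordered pairs of distinct elements; the order, natural or
  pulled back along \<open>p\<close>, only selects how each pair is written.\<close>

lemma prod_pairs_symmetric:
  fixes g :: "'b::linorder \<Rightarrow> 'b \<Rightarrow> 'c::comm_monoid_mult" and p :: "'b \<Rightarrow> 'd::linorder"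
  assumes "inj_on p S" "\<And>x y. g x y = g y x"
  shows "(\<Prod>(x, y) | x \<in> S \<and> y \<in> S \<and> p x < p y. g x y) = (\<Prod>(x, y) | x \<in> S \<and> y \<in> S \<and> x < y. g x y)"
proof -
  let ?sort = "\<lambda>(x::'b, y). if x < y then (x, y) else (y, x)"
  let ?psort = "\<lambda>(x, y). if p x < p y then (x, y) else (y, x)"
  have "p y < p x" if "x \<in> S" "y \<in> S" "x < y" "p y \<le> p x" for x y
    using that inj_onD[OF assms(1), of x y] by (auto simp: order.order_iff_strict)
  then show ?thesis
    by (intro prod.reindex_bij_witness[where i = ?psort and j = ?sort])
       (auto simp: assms(2) not_less split: if_splits intro: le_neq_trans)
qed

definition inversion_sign :: "'b::linorder set \<Rightarrow> ('b \<Rightarrow> 'b) \<Rightarrow> int" where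
  "inversion_sign S p = (\<Prod>(x, y) | x \<in> S \<and> y \<in> S \<and> x < y. order_sign (p x) (p y))"

text \<open>The factor \<open>?g\<close> records whether \<open>p\<close> keeps the order of two
  values. Exchanging the values flips both order signs, so \<open>?g\<close> is symmetric and its
  product over pairs survives reindexing by \<open>q\<close>.\<close>

lemma inversion_sign_compose:
  assumes "p permutes S" "q permutes S"
  shows "inversion_sign S (p \<circ> q) = inversion_sign S p * inversion_sign S q"
proof -
  let ?g = "\<lambda>u v. if u = v then 1 else order_sign (p u) (p v) * order_sign u v"
  have inj: "inj p" "inj q" using assms permutes_inj by auto
  have sym: "?g u v = ?g v u" for u v
    using inj(1) by (auto simp: order_sign_def inj_eq)
  have "inversion_sign S (p \<circ> q) =
      (\<Prod>(x, y) | x \<in> S \<and> y \<in> S \<and> x < y. ?g (q x) (q y) * order_sign (q x) (q y))"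
    unfolding inversion_sign_def
    by (rule prod.cong) (use inj in \<open>auto simp: order_sign_def inj_eq\<close>)
  also have "\<dots> = (\<Prod>(x, y) | x \<in> S \<and> y \<in> S \<and> x < y. ?g (q x) (q y)) * inversion_sign S q"
    unfolding inversion_sign_def by (simp add: prod.distrib case_prod_unfold)
  also have "(\<Prod>(x, y) | x \<in> S \<and> y \<in> S \<and> x < y. ?g (q x) (q y)) =
      (\<Prod>(x, y) | x \<in> S \<and> y \<in> S \<and> q x < q y. ?g (q x) (q y))"
    by (rule prod_pairs_symmetric[symmetric]) (use inj sym in \<open>auto intro: inj_on_subset\<close>)
  also have "\<dots> = (\<Prod>(x, y) | x \<in> S \<and> y \<in> S \<and> x < y. ?g x y)"
    by (rule prod.reindex_bij_witness[where i = "map_prod (inv q) (inv q)" and j = "map_prod q q"])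
       (use assms(2) in \<open>auto simp: permutes_inverses permutes_in_image permutes_inv\<close>)
  also have "\<dots> = inversion_sign S p"
    unfolding inversion_sign_def by (rule prod.cong) (auto simp: order_sign_def)
  finally show ?thesis .
qed

text \<open>The inverted pairs are (a, b) and, for each x of \<open>S\<close> strictly between, (a,
  x) and (x, b): an odd number.\<close>

lemma inversion_sign_transpose:
  assumes "finite S" "a \<in> S" "b \<in> S" "a < b"
  shows "inversion_sign S (transpose a b) = - 1"
proof -
  let ?p = "transpose a b"
  let ?T = "{(x, y). x \<in> S \<and> y \<in> S \<and> x < y}" and ?I = "{x \<in> S. a < x \<and> x < b}"
  have fin: "finite ?T" by (rule finite_subset[of _ "S \<times> S"]) (use assms in auto)
  have "{(x, y) \<in> ?T. \<not> ?p x < ?p y} = insert (a, b) (Pair a ` ?I \<union> (\<lambda>x. (x, b)) ` ?I)"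
    using assms by (auto simp: transpose_def split: if_splits)
  moreover have "card \<dots> = Suc (card ?I + card ?I)"
  proof -
    have "card (Pair a ` ?I \<union> (\<lambda>x. (x, b)) ` ?I) = card (Pair a ` ?I) + card ((\<lambda>x. (x, b)) ` ?I)"
      using assms(1) by (intro card_Un_disjoint) auto
    also have "\<dots> = card ?I + card ?I" by (simp add: card_image inj_on_def)
    finally show ?thesis using assms(1) by (subst card_insert_disjoint) auto
  qed
  ultimately have card: "card {(x, y) \<in> ?T. \<not> ?p x < ?p y} = Suc (card ?I + card ?I)" by simp
  have "inversion_sign S ?p = (\<Prod>e\<in>?T. if case e of (x, y) \<Rightarrow> \<not> ?p x < ?p y then - 1 else 1)"
    unfolding inversion_sign_def by (rule prod.cong) (auto simp: order_sign_def)
  also have "\<dots> = (- 1) ^ card {(x, y) \<in> ?T. \<not> ?p x < ?p y}"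
    using fin by (subst prod.If_cases) (auto simp: Int_def intro!: arg_cong[where f = "\<lambda>A. (- 1) ^ card A"])
  finally show ?thesis unfolding card by simp
qed

text \<open>Both sides change sign under composition with a transposition. This links the parity
  sign to the inversion count that matchings produce.\<close>

lemma sign_eq_inversion_sign:
  assumes "p permutes S" "finite S"
  shows "sign p = inversion_sign S p"
  using assms
proof (induction rule: permutes_induct)
  case id
  have "inversion_sign S id = 1"
    unfolding inversion_sign_def by (rule prod.neutral) (auto simp: order_sign_def)
  then show ?case by (metis sign_id)
next
  case (swap a b p)
  have "inversion_sign S (transpose a b) = - 1"
    using inversion_sign_transpose[OF assms(2), of a b] inversion_sign_transpose[OF assms(2), of b a] swap
    by (metis linorder_neqE transpose_commute)
  then have "inversion_sign S (transpose a b \<circ> p) = - inversion_sign S p"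
    using inversion_sign_compose[of "transpose a b" S p] swap by (simp add: permutes_swap_id)
  moreover have "sign (transpose a b \<circ> p) = - sign p"
    using swap assms(2) by (subst sign_compose) (auto simp: sign_swap_id permutation_swap_id intro:
        permutes_imp_permutation)
  ultimately show ?case using swap by metis
qed

text \<open>The form in which matchings yield the sign: for row x one looks at the rows y whose
  skipped column lies further right and asks whether y is above x.\<close>

lemma sign_eq_prod_image_order:
  assumes "p permutes S" "finite S"
  shows "sign p = (\<Prod>x\<in>S. \<Prod>y | y \<in> S \<and> p x < p y. order_sign x y)"
proof -
  let ?g = "\<lambda>u v. if u = v then 1 else order_sign (p u) (p v) * order_sign u v"
  have inj: "inj p" using assms permutes_inj by auto
  have sym: "?g u v = ?g v u" for u v
    using inj by (auto simp: order_sign_def inj_eq)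
  have "(\<Prod>x\<in>S. \<Prod>y | y \<in> S \<and> p x < p y. order_sign x y) =
      (\<Prod>(x, y) | x \<in> S \<and> y \<in> S \<and> p x < p y. order_sign x y)"
    using assms(2) by (subst prod.Sigma) (auto intro!: prod.cong)
  also have "\<dots> = (\<Prod>(x, y) | x \<in> S \<and> y \<in> S \<and> p x < p y. ?g x y)"
    by (rule prod.cong) (auto simp: order_sign_def)
  also have "\<dots> = (\<Prod>(x, y) | x \<in> S \<and> y \<in> S \<and> x < y. ?g x y)"
    by (rule prod_pairs_symmetric) (use inj sym in \<open>auto intro: inj_on_subset\<close>)
  also have "\<dots> = inversion_sign S p"
    unfolding inversion_sign_def by (rule prod.cong) (auto simp: order_sign_def)
  finally show ?thesis using sign_eq_inversion_sign[OF assms] by simp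
qed

text \<open>In a general commutative ring 2 may be a zero divisor, so a sum equal to its own
  negative need not vanish. The predicate \<open>Q\<close> selects one member of each pair, so that
  the two halves cancel.\<close>

lemma sum_involution_cancel:
  fixes g :: "'b \<Rightarrow> 'a::comm_ring_1"
  assumes "finite S"
    and "\<And>h. h \<in> S \<Longrightarrow> f h \<in> S" "\<And>h. h \<in> S \<Longrightarrow> f (f h) = h"
    and "\<And>h. h \<in> S \<Longrightarrow> g (f h) = - g h" "\<And>h. h \<in> S \<Longrightarrow> Q (f h) \<longleftrightarrow> \<not> Q h"
  shows "sum g S = 0"
proof -
  have "(\<Sum>h | h \<in> S \<and> Q h. - g h) = (\<Sum>h | h \<in> S \<and> \<not> Q h. g h)"
    by (rule sum.reindex_bij_witness[where i = f and j = f]) (use assms in auto)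
  moreover have "sum g S = (\<Sum>h | h \<in> S \<and> Q h. g h) + (\<Sum>h | h \<in> S \<and> \<not> Q h. g h)"
    using assms(1) by (subst sum.union_disjoint[symmetric]) (auto intro!: sum.cong)
  ultimately show ?thesis by (simp add: sum_negf eq_neg_iff_add_eq_0 neg_eq_iff_add_eq_0)
qed

section \<open>The signed sum over matchings\<close>

text \<open>Being \<open>extensional\<close> makes the function unique for each matching, so that
  sums can be transferred by a bijection.\<close>

definition matching_funs :: "nat \<Rightarrow> (nat \<times> nat \<Rightarrow> nat \<times> nat) set" where
  "matching_funs k = {h. h \<in> extensional (black_idx k) \<and> bij_betw h (black_idx k) (white_idx k) \<and>
     (\<forall>b\<in>black_idx k. adj (h b) b)}"

text \<open>The weight of an edge of the Aztec diamond times its sign in the standard Kasteleyn orientation: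
  \<open>A i j\<close> stands for \<open>c\<^sub>i\<^sub>,\<^sub>j - d\<^sub>i\<close> and \<open>B i j\<close> for \<open>c\<^sub>i\<^sub>,\<^sub>j - d\<^sub>i\<^sub>-\<^sub>1\<close>.\<close>

definition edge_weight ::
  "(nat \<Rightarrow> nat \<Rightarrow> 'a::comm_ring_1) \<Rightarrow> (nat \<Rightarrow> nat \<Rightarrow> 'a) \<Rightarrow> nat \<times> nat \<Rightarrow> nat \<times> nat \<Rightarrow> 'a" where
  "edge_weight A B = (\<lambda>(i, j) (p, q). if p = i then A i q else if j = q then B i q else - B i q)"

lemma finite_idx: "finite (black_idx k)" "finite (white_idx k)"
  by (simp_all add: black_idx_def white_idx_def)

lemma finite_matching_funs: "finite (matching_funs k)"
proof (rule finite_subset)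
  show "matching_funs k \<subseteq> PiE (black_idx k) (\<lambda>_. white_idx k)"
    by (auto simp: matching_funs_def PiE_def bij_betw_def)
qed (simp add: finite_PiE finite_idx)

section \<open>Cancellation of matchings with a clash\<close>

definition clash :: "nat \<Rightarrow> (nat \<times> nat \<Rightarrow> nat \<times> nat) \<Rightarrow> nat \<Rightarrow> nat \<Rightarrow> bool" where
  "clash k h i j \<longleftrightarrow> Suc i < k \<and> j \<le> k \<and> fst (h (i, j)) = Suc i \<and> fst (h (Suc i, j)) = Suc i"

lemma matching_funsD:
  assumes "h \<in> matching_funs k" "i < k" "j \<le> k"
  shows "fst (h (i, j)) = i \<or> fst (h (i, j)) = Suc i"
    and "snd (h (i, j)) = j \<or> Suc (snd (h (i, j))) = j"
    and "snd (h (i, j)) < k"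
proof -
  have b: "(i, j) \<in> black_idx k" using assms by (simp add: black_idx_def)
  then have "adj (h (i, j)) (i, j)" using assms(1) by (simp add: matching_funs_def)
  then show "fst (h (i, j)) = i \<or> fst (h (i, j)) = Suc i"
    "snd (h (i, j)) = j \<or> Suc (snd (h (i, j))) = j"
    by (auto simp: adj_def split: prod.splits)
  have "h (i, j) \<in> white_idx k" using b assms(1) by (auto simp: matching_funs_def bij_betw_def)
  then show "snd (h (i, j)) < k" by (auto simp: white_idx_def)
qed

lemma matching_funs_white: "h \<in> matching_funs k \<Longrightarrow> b \<in> black_idx k \<Longrightarrow> h b \<in> white_idx k"
  using bij_betw_apply[of h "black_idx k" "white_idx k" b] by (simp add: matching_funs_def)

lemma matching_funs_inj: "h \<in> matching_funs k \<Longrightarrow> inj_on h (black_idx k)"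
  by (simp add: matching_funs_def bij_betw_def)

text \<open>The two blacks are adjacent to the same two whites of column \<open>Suc i\<close>, those
  in rows j and j - 1. The swap keeps the column of every partner, which is all that
  \<open>clash\<close> inspects.\<close>

lemma swap_clash:
  assumes h: "h \<in> matching_funs k" and cl: "clash k h i j"
  defines "h' \<equiv> h \<circ> transpose (i, j) (Suc i, j)"
  shows "h' \<in> matching_funs k" "fst \<circ> h' = fst \<circ> h"
    and "snd (h' (i, j)) = j \<longleftrightarrow> snd (h (i, j)) \<noteq> j"
    and "(\<Prod>b\<in>black_idx k. edge_weight A B (h' b) b) = - (\<Prod>b\<in>black_idx k. edge_weight A B (h b) b)"
proof -
  let ?b = "(i, j)" and ?b' = "(Suc i, j)"
  have ij: "Suc i < k" "j \<le> k" "fst (h ?b) = Suc i" "fst (h ?b') = Suc i"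
    using cl by (auto simp: clash_def)
  have bb: "?b \<in> black_idx k" "?b' \<in> black_idx k" using ij by (auto simp: black_idx_def)
  have perm: "transpose ?b ?b' permutes black_idx k" using bb by (rule permutes_swap_id)
  show "fst \<circ> h' = fst \<circ> h" using ij by (auto simp: h'_def transpose_def fun_eq_iff)
  have "h ?b \<noteq> h ?b'" using matching_funs_inj[OF h] bb by (auto dest: inj_onD)
  then have ne: "snd (h ?b) \<noteq> snd (h ?b')" using ij by (simp add: prod_eq_iff)
  have row: "snd (h ?b) = j \<or> Suc (snd (h ?b)) = j" "snd (h ?b') = j \<or> Suc (snd (h ?b')) = j"
    using matching_funsD(2)[OF h, of i j] matching_funsD(2)[OF h, of "Suc i" j] ij by auto
  \<comment> \<open>Two distinct whites of one column with rows among j and j - 1: exactly one is in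
    row j. This also supplies the predicate that splits the cancelling pairs.\<close>
  then have flip: "snd (h ?b') = j \<longleftrightarrow> snd (h ?b) \<noteq> j" using ne by auto
  then show "snd (h' ?b) = j \<longleftrightarrow> snd (h ?b) \<noteq> j" by (simp add: h'_def)
  show "h' \<in> matching_funs k"
  proof -
    have "bij_betw h' (black_idx k) (white_idx k)"
      using h permutes_imp_bij[OF perm] unfolding h'_def matching_funs_def
      by (auto intro: bij_betw_trans)
    moreover have "h' \<in> extensional (black_idx k)"
      using h permutes_not_in[OF perm] by (auto simp: h'_def matching_funs_def extensional_def)
    moreover have "adj (h' b) b" if "b \<in> black_idx k" for b
    proof -
      consider "b = ?b" | "b = ?b'" | "b \<noteq> ?b" "b \<noteq> ?b'" by blast
      then show ?thesis
      proof cases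
        case 1
        then show ?thesis using ij row by (auto simp: h'_def adj_def split: prod.splits)
      next
        case 2
        then show ?thesis using ij row by (auto simp: h'_def adj_def split: prod.splits)
      next
        case 3
        then show ?thesis using h that by (simp add: h'_def matching_funs_def transpose_def)
      qed
    qed
    ultimately show ?thesis by (simp add: matching_funs_def)
  qed
  let ?w = "edge_weight A B" and ?R = "black_idx k - {?b} - {?b'}"
  have split: "(\<Prod>b\<in>black_idx k. f b) = f ?b * (f ?b' * (\<Prod>b\<in>?R. f b))" for f :: "nat \<times> nat \<Rightarrow> 'a"
    using prod.remove[OF finite_idx(1) bb(1), of f] prod.remove[of "black_idx k - {?b}" ?b' f] bb
    by (simp add: finite_idx)
  have "(\<Prod>b\<in>?R. ?w (h' b) b) = (\<Prod>b\<in>?R. ?w (h b) b)"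
    by (rule prod.cong) (auto simp: h'_def transpose_def)
  \<comment> \<open>Black (i + 1, j) has weight \<open>A (Suc i) j\<close> with either partner,
    whereas the weight of (i, j) switches between \<open>B (Suc i) j\<close> and its
    negative.\<close>
  moreover have "?w (h' ?b) ?b * ?w (h' ?b') ?b' = - (?w (h ?b) ?b * ?w (h ?b') ?b')"
    using ij flip by (cases "h ?b"; cases "h ?b'") (auto simp: h'_def edge_weight_def)
  ultimately show "(\<Prod>b\<in>black_idx k. ?w (h' b) b) = - (\<Prod>b\<in>black_idx k. ?w (h b) b)"
    by (simp add: split flip: mult.assoc)
qed

definition clash_free :: "nat \<Rightarrow> (nat \<times> nat \<Rightarrow> nat \<times> nat) set" where
  "clash_free k = {h \<in> matching_funs k. \<forall>i j. \<not> clash k h i j}"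

lemma sum_clash_free:
  fixes A B :: "nat \<Rightarrow> nat \<Rightarrow> 'a::comm_ring_1"
  shows "(\<Sum>h\<in>matching_funs k. \<Prod>b\<in>black_idx k. edge_weight A B (h b) b) =
    (\<Sum>h\<in>clash_free k. \<Prod>b\<in>black_idx k. edge_weight A B (h b) b)"
proof -
  \<comment> \<open>The chosen clash depends only on the columns of the whites, which the swap preserves; hence the
    swap is an involution.\<close>
  let ?P = "\<lambda>h. SOME p. clash k h (fst p) (snd p)"
  let ?f = "\<lambda>h. h \<circ> transpose (?P h) (Suc (fst (?P h)), snd (?P h))"
  have cl: "clash k h (fst (?P h)) (snd (?P h))" if "h \<in> matching_funs k - clash_free k" for h
  proof -
    have "\<exists>p. clash k h (fst p) (snd p)" using that by (auto simp: clash_free_def)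
    then show ?thesis by (rule someI_ex)
  qed
  have clash_fst: "clash k h' = clash k h" if "fst \<circ> h' = fst \<circ> h" for h h'
    using that by (intro ext) (auto simp: clash_def fun_eq_iff)
  have "(\<Sum>h\<in>matching_funs k - clash_free k. \<Prod>b\<in>black_idx k. edge_weight A B (h b) b) = 0"
  proof (rule sum_involution_cancel[where f = ?f and Q = "\<lambda>h. snd (h (?P h)) = snd (?P h)"])
    show "finite (matching_funs k - clash_free k)" by (simp add: finite_matching_funs)
    fix h assume h: "h \<in> matching_funs k - clash_free k"
    note swap = swap_clash[OF _ cl[OF h], unfolded prod.collapse]
    have hm: "h \<in> matching_funs k" using h by simp
    have same: "clash k (?f h) = clash k h" by (rule clash_fst) (rule swap(2)[OF hm])
    then have P: "?P (?f h) = ?P h" by simp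
    show "?f h \<in> matching_funs k - clash_free k"
      using swap(1)[OF hm] cl[OF h] same by (auto simp: clash_free_def)
    show "?f (?f h) = h" unfolding P by (simp add: comp_assoc)
    show "(\<Prod>b\<in>black_idx k. edge_weight A B (?f h b) b) = - (\<Prod>b\<in>black_idx k. edge_weight A B (h b) b)"
      by (rule swap(4)[OF hm])
    show "snd (?f h (?P (?f h))) = snd (?P (?f h)) \<longleftrightarrow> \<not> snd (h (?P h)) = snd (?P h)"
      unfolding P by (rule swap(3)[OF hm])
  qed
  moreover have "clash_free k \<subseteq> matching_funs k" by (auto simp: clash_free_def)
  ultimately show ?thesis
    by (simp add: sum.subset_diff[OF _ finite_matching_funs])
qed

section \<open>Clash-free matchings correspond to permutations\<close>

definition perm_matching :: "nat \<Rightarrow> (nat \<Rightarrow> nat) \<Rightarrow> nat \<times> nat \<Rightarrow> nat \<times> nat" where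
  "perm_matching k \<tau> = restrict (\<lambda>(i, j). let c = if i < \<tau> j then i else Suc i
     in (c, if j < inv \<tau> c then j else j - 1)) (black_idx k)"

text \<open>Row \<open>inv \<tau> c\<close> is the one that leaves white column c out. Rows below it
  take the white at their own height and rows above it the white one lower, which fills the k places
  of the column.\<close>

lemma perm_matching_clash_free:
  assumes "\<tau> permutes {0..k}"
  shows "perm_matching k \<tau> \<in> clash_free k"
proof -
  let ?h = "perm_matching k \<tau>" and ?c = "\<lambda>i j. if i < \<tau> j then i else Suc i"
  have h: "?h (i, j) = (?c i j, if j < inv \<tau> (?c i j) then j else j - 1)" if "i < k" "j \<le> k" for i j
    using that by (simp add: perm_matching_def black_idx_def)
  have bnd: "\<tau> j \<le> k" "inv \<tau> j \<le> k" if "j \<le> k" for j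
    using that permutes_in_image[OF assms, of j] permutes_in_image[OF permutes_inv[OF assms], of j] by auto
  have ne: "j \<noteq> inv \<tau> (?c i j)" for i j
  proof
    assume "j = inv \<tau> (?c i j)"
    then have "\<tau> j = ?c i j" using permutes_inverses(1)[OF assms] by metis
    then show False by (simp split: if_splits)
  qed
  have white: "?h b \<in> white_idx k" and adj: "adj (?h b) b" if "b \<in> black_idx k" for b
  proof -
    obtain i j where b: "b = (i, j)" "i < k" "j \<le> k" using \<open>b \<in> black_idx k\<close> by (auto simp: black_idx_def)
    have "?c i j \<le> k" using b bnd(1) by (simp add: Suc_leI)
    then show "?h b \<in> white_idx k" using b h[OF b(2,3)] ne[of j i] bnd(2)[of "?c i j"]
      by (auto simp: white_idx_def)
    show "adj (?h b) b" using b h[OF b(2,3)] ne[of j i] by (auto simp: adj_def)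
  qed
  have "inj_on ?h (black_idx k)"
  proof (rule inj_onI)
    fix b b' assume bb: "b \<in> black_idx k" "b' \<in> black_idx k" and eq: "?h b = ?h b'"
    obtain i j where b: "b = (i, j)" "i < k" "j \<le> k" using bb by (auto simp: black_idx_def)
    obtain i' j' where b': "b' = (i', j')" "i' < k" "j' \<le> k" using bb by (auto simp: black_idx_def)
    have e: "(?c i j, if j < inv \<tau> (?c i j) then j else j - 1) =
        (?c i' j', if j' < inv \<tau> (?c i' j') then j' else j' - 1)"
      using eq unfolding b(1) b'(1) h[OF b(2,3)] h[OF b'(2,3)] .
    then have col: "?c i j = ?c i' j'" by (simp only: prod.inject)
    define u where "u = inv \<tau> (?c i j)"
    have u: "u = inv \<tau> (?c i' j')" unfolding u_def by (simp only: col)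
    have "j \<noteq> u" unfolding u_def by (rule ne)
    moreover have "j' \<noteq> u" unfolding u by (rule ne)
    moreover have "(if j < u then j else j - 1) = (if j' < u then j' else j' - 1)"
      using e unfolding prod.inject u_def[symmetric] u[symmetric] by (rule conjunct2)
    ultimately have "j = j'" by (auto split: if_splits)
    then show "b = b'" using col b b' by (auto split: if_splits)
  qed
  \<comment> \<open>Both index sets have k(k+1) elements, so injectivity gives surjectivity.\<close>
  moreover have "?h ` black_idx k = white_idx k"
  proof (rule card_subset_eq)
    show "card (?h ` black_idx k) = card (white_idx k)"
      using card_image[OF calculation] by (simp add: black_idx_def white_idx_def)
  qed (use white finite_idx in auto)
  moreover have "\<not> clash k ?h i j" for i j
    by (auto simp: clash_def h)
  ultimately show ?thesis using adj
    by (auto simp: clash_free_def matching_funs_def bij_betw_def perm_matching_def)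
qed

lemma inj_perm_matching: "inj_on (perm_matching k) {\<tau>. \<tau> permutes {0..k}}"
proof (rule inj_onI)
  fix \<sigma> \<tau> assume *: "\<sigma> \<in> {\<tau>. \<tau> permutes {0..k}}" "\<tau> \<in> {\<tau>. \<tau> permutes {0..k}}"
    "perm_matching k \<sigma> = perm_matching k \<tau>"
  have "\<sigma> j = \<tau> j" if j: "j \<le> k" for j
  proof -
    have "i < \<sigma> j \<longleftrightarrow> i < \<tau> j" if "i < k" for i
      using fun_cong[OF *(3), of "(i, j)"] that j
      by (auto simp: perm_matching_def black_idx_def Let_def split: if_splits)
    moreover have "\<sigma> j \<le> k" "\<tau> j \<le> k"
      using *(1,2) j permutes_in_image[of \<sigma> "{0..k}" j] permutes_in_image[of \<tau> "{0..k}" j] by auto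
    ultimately show ?thesis by (metis linorder_neqE_nat less_irrefl order_less_le_trans)
  qed
  moreover have "\<sigma> j = \<tau> j" if "\<not> j \<le> k" for j
    using *(1,2) that by (simp add: permutes_def)
  ultimately show "\<sigma> = \<tau>" by blast
qed

text \<open>Once a black is matched to its right, the next one cannot use the column between them
  and must go right as well; so within a row the shift starts at some t and persists.\<close>

lemma shift_threshold:
  fixes f :: "nat \<Rightarrow> nat"
  assumes "\<And>i. i < k \<Longrightarrow> f i = i \<or> f i = Suc i"
    and "\<And>i. Suc i < k \<Longrightarrow> f i = Suc i \<Longrightarrow> f (Suc i) \<noteq> Suc i"
  shows "\<exists>t\<le>k. \<forall>i<k. f i = (if i < t then i else Suc i)"
  using assms
proof (induction k)
  case (Suc k)
  then obtain t where t: "t \<le> k" "\<forall>i<k. f i = (if i < t then i else Suc i)" by auto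
  show ?case
  proof (cases "f k = k")
    case True
    \<comment> \<open>A black that stays after an earlier shift would clash, so here nothing has
      shifted yet and the threshold moves on to \<open>Suc k\<close>.\<close>
    have "t = k"
    proof (rule ccontr)
      assume "t \<noteq> k"
      then obtain m where m: "k = Suc m" "t \<le> m" using t(1) by (cases k) auto
      then have "f m = Suc m" using t(2) by simp
      then show False using Suc.prems(2)[of m] True m by simp
    qed
    then show ?thesis using t True by (intro exI[of _ "Suc k"]) (auto simp: less_Suc_eq)
  next
    case False
    then have "f k = Suc k" using Suc.prems(1)[of k] by simp
    then show ?thesis using t by (intro exI[of _ t]) (auto simp: less_Suc_eq)
  qed
qed simp

text \<open>Forced from both ends: row 0 has no white below it and each row under the gap then
  blocks the next from descending, while row k has no white at its own height and the blocking runs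
  downwards to the gap.\<close>

lemma gap_shift:
  fixes \<rho> :: "nat \<Rightarrow> nat"
  assumes inj: "inj_on \<rho> ({0..k} - {u})"
    and \<rho>: "\<And>j. j \<le> k \<Longrightarrow> j \<noteq> u \<Longrightarrow> \<rho> j < k \<and> (\<rho> j = j \<or> Suc (\<rho> j) = j)"
    and "u \<le> k" "j \<le> k" "j \<noteq> u"
  shows "\<rho> j = (if j < u then j else j - 1)"
proof (cases "j < u")
  case True
  then have "\<rho> j = j"
  proof (induction j)
    case 0
    then show ?case using \<rho>[of 0] by auto
  next
    case (Suc j)
    then have "\<rho> (Suc j) \<noteq> \<rho> j" using inj_onD[OF inj, of "Suc j" j] \<open>u \<le> k\<close> by auto
    then show ?case using \<rho>[of "Suc j"] Suc \<open>u \<le> k\<close> by auto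
  qed
  then show ?thesis using True by simp
next
  case False
  with \<open>j \<noteq> u\<close> have "u < j" by simp
  have "u < j \<longrightarrow> Suc (\<rho> j) = j" using \<open>j \<le> k\<close>
  proof (induction rule: inc_induct)
    case base
    then show ?case using \<rho>[of k] by auto
  next
    case (step j)
    then show ?case using \<rho>[of j] inj_onD[OF inj, of "Suc j" j] by auto
  qed
  then show ?thesis using False \<open>u < j\<close> by auto
qed

lemma clash_free_eq: "clash_free k = perm_matching k ` {\<tau>. \<tau> permutes {0..k}}"
proof (intro equalityI subsetI)
  fix h assume "h \<in> clash_free k"
  then have h: "h \<in> matching_funs k" and nc: "\<And>i j. \<not> clash k h i j" by (auto simp: clash_free_def)
  have "\<exists>t\<le>k. \<forall>i<k. fst (h (i, j)) = (if i < t then i else Suc i)" if "j \<le> k" for j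
    by (rule shift_threshold)
       (use matching_funsD(1)[OF h] nc that in \<open>auto simp: clash_def\<close>)
  then obtain t where t: "\<And>j. j \<le> k \<Longrightarrow> t j \<le> k"
    and col: "\<And>i j. i < k \<Longrightarrow> j \<le> k \<Longrightarrow> fst (h (i, j)) = (if i < t j then i else Suc i)" by metis
  have surj: "h ` black_idx k = white_idx k"
    using h by (simp add: matching_funs_def bij_betw_def)
  have "inj_on t {0..k}"
  proof (rule inj_onI, rule ccontr)
    fix j j' assume jj: "j \<in> {0..k}" "j' \<in> {0..k}" "t j = t j'" "j \<noteq> j'"
    \<comment> \<open>\<open>r l\<close> is the black partner of the white (t j, l). These k blacks
      lie in distinct rows, none of which may skip column \<open>t j\<close>.\<close>
    define r where "r l = inv_into (black_idx k) h (t j, l)" for l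
    have w: "(t j, l) \<in> h ` black_idx k" if "l < k" for l
      unfolding surj using that t[of j] jj(1) by (simp add: white_idx_def)
    have r: "r l \<in> black_idx k" "h (r l) = (t j, l)" if "l < k" for l
      unfolding r_def by (rule inv_into_into[OF w[OF that]], rule f_inv_into_f[OF w[OF that]])
    have rl: "fst (r l) < k" "snd (r l) \<le> k"
      "t j = (if fst (r l) < t (snd (r l)) then fst (r l) else Suc (fst (r l)))" if "l < k" for l
    proof -
      show *: "fst (r l) < k" "snd (r l) \<le> k" using r(1)[OF that] by (auto simp: black_idx_def)
      show "t j = (if fst (r l) < t (snd (r l)) then fst (r l) else Suc (fst (r l)))"
        using col[OF *] unfolding prod.collapse r(2)[OF that] by simp
    qed
    have "inj_on (snd \<circ> r) {0..<k}"
    proof (rule inj_onI)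
      fix l l' assume ll: "l \<in> {0..<k}" "l' \<in> {0..<k}" "(snd \<circ> r) l = (snd \<circ> r) l'"
      have "(if x < z then x else Suc x) = (if y < z then y else Suc y) \<Longrightarrow> x = y" for x y z :: nat
        by (simp split: if_splits)
      moreover have "snd (r l) = snd (r l')" using ll(3) by simp
      ultimately have "r l = r l'" using rl(3)[of l] rl(3)[of l'] ll(1,2)
        by (metis atLeastLessThan_iff prod_eqI)
      then have "(t j, l) = (t j, l')" using r(2)[of l] r(2)[of l'] ll(1,2) by (metis atLeastLessThan_iff)
      then show "l = l'" by simp
    qed
    moreover have "(snd \<circ> r) ` {0..<k} \<subseteq> {0..k} - {j, j'}"
    proof
      fix q assume "q \<in> (snd \<circ> r) ` {0..<k}"
      then obtain l where l: "l < k" "q = snd (r l)" by auto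
      have "(if x < z then x else Suc x) \<noteq> z" for x z :: nat by simp
      then have "t q \<noteq> t j" using rl(3)[OF l(1)] l(2) by metis
      then have "q \<noteq> j" "q \<noteq> j'" using jj(3) by metis+
      then show "q \<in> {0..k} - {j, j'}" using rl(2) l by simp
    qed
    \<comment> \<open>The count gives k \<le> k - 1, hence k = 0, and then row 0 is the only row,
      against j \<noteq> j'.\<close>
    ultimately have "card {0..<k} \<le> card ({0..k} - {j, j'})" by (rule card_inj_on_le) simp
    also have "\<dots> = k - 1" using jj by (subst card_Diff_subset) auto
    finally show False using jj by auto
  qed
  define \<tau> where "\<tau> j = (if j \<le> k then t j else j)" for j
  have "inj_on \<tau> {0..k}" using \<open>inj_on t {0..k}\<close> by (auto simp: \<tau>_def inj_on_def)
  moreover from this have "\<tau> ` {0..k} = {0..k}"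
    by (intro endo_inj_surj) (auto simp: \<tau>_def t)
  ultimately have perm: "\<tau> permutes {0..k}"
    by (intro bij_imp_permutes) (auto simp: bij_betw_def \<tau>_def)
  have "h b = perm_matching k \<tau> b" for b
  proof (cases "b \<in> black_idx k")
    case True
    then obtain i j where b: "b = (i, j)" "i < k" "j \<le> k" by (auto simp: black_idx_def)
    define c where "c = (if i < t j then i else Suc i)"
    have col_c: "fst (h (i, j)) = c" using col b by (simp add: c_def)
    have c_le: "c \<le> k" using t[of j] b by (auto simp: c_def)
    \<comment> \<open>\<open>?i j\<close> undoes the shift: it is the position in row j of the black
      matched into column c. Thus \<open>?\<rho>\<close> lists the white rows used in column c, and
      \<open>?u\<close> is the row absent from it.\<close>
    let ?u = "inv \<tau> c" and ?i = "\<lambda>j. if c < t j then c else c - 1"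
    let ?\<rho> = "\<lambda>j. snd (h (?i j, j))"
    have u: "?u \<le> k" using permutes_in_image[OF permutes_inv[OF perm], of c] c_le by auto
    have ne: "t j' \<noteq> c" if "j' \<le> k" "j' \<noteq> ?u" for j'
      using that permutes_inverses(2)[OF perm, of j'] by (auto simp: \<tau>_def)
    have i: "?i j' < k" "fst (h (?i j', j')) = c" if "j' \<le> k" "j' \<noteq> ?u" for j'
    proof -
      show "?i j' < k" using ne[OF that] t[OF that(1)] c_le b by (auto split: if_splits)
      then show "fst (h (?i j', j')) = c" using col[of "?i j'" j'] that ne[OF that] by (auto split:
          if_splits)
    qed
    have "inj_on ?\<rho> ({0..k} - {?u})"
    proof (rule inj_onI)
      fix x y assume xy: "x \<in> {0..k} - {?u}" "y \<in> {0..k} - {?u}" "?\<rho> x = ?\<rho> y"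
      then have "h (?i x, x) = h (?i y, y)" using i(2)[of x] i(2)[of y] by (simp add: prod_eq_iff)
      then have "(?i x, x) = (?i y, y)"
        by (rule inj_onD[OF matching_funs_inj[OF h]]) (use xy i(1) in \<open>auto simp: black_idx_def\<close>)
      then show "x = y" by simp
    qed
    moreover have "?\<rho> j' < k \<and> (?\<rho> j' = j' \<or> Suc (?\<rho> j') = j')" if "j' \<le> k" "j' \<noteq> ?u" for j'
      using matching_funsD(2,3)[OF h i(1)[OF that] that(1)] by simp
    moreover have ju: "j \<noteq> ?u"
    proof
      assume "j = ?u"
      then have "\<tau> j = c" using permutes_inverses(1)[OF perm] by metis
      then show False using c_def b by (auto simp: \<tau>_def split: if_splits)
    qed
    ultimately have "?\<rho> j = (if j < ?u then j else j - 1)"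
      using u b(3) by (intro gap_shift) auto
    moreover have "?i j = i" by (auto simp: c_def)
    ultimately have "snd (h (i, j)) = (if j < ?u then j else j - 1)" by (simp only:)
    then have "h b = (c, if j < ?u then j else j - 1)" by (simp add: prod_eq_iff b(1) col_c)
    also have "\<dots> = perm_matching k \<tau> b"
      using True b(2,3) by (simp add: b(1) perm_matching_def \<tau>_def c_def)
    finally show ?thesis .
  next
    case False
    then show ?thesis using h by (cases b) (simp add: perm_matching_def matching_funs_def extensional_def)
  qed
  then show "h \<in> perm_matching k ` {\<tau>. \<tau> permutes {0..k}}" using perm by blast
qed (auto intro: perm_matching_clash_free)

text \<open>Left of the threshold a row contributes plain \<open>A\<close> factors; right of it
  every factor is \<open>B\<close> with a sign telling whether the row lies below or above the gap
  of its white column.\<close>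

lemma perm_matching_weight:
  fixes A B :: "nat \<Rightarrow> nat \<Rightarrow> 'a::comm_ring_1"
  assumes "\<tau> permutes {0..k}"
  shows "(\<Prod>b\<in>black_idx k. edge_weight A B (perm_matching k \<tau> b) b) =
    of_int (sign \<tau>) * (\<Prod>j=0..k. (\<Prod>i\<in>{0..<\<tau> j}. A i j) * (\<Prod>i\<in>{\<tau> j<..k}. B i j))"
proof -
  let ?w = "\<lambda>i j. edge_weight A B (perm_matching k \<tau> (i, j)) (i, j)"
  have bnd: "\<tau> j \<le> k" if "j \<le> k" for j
    using that permutes_in_image[OF assms, of j] by auto
  have row: "(\<Prod>i\<in>{0..<k}. ?w i j) = of_int (\<Prod>y | y \<in> {0..k} \<and> \<tau> j < \<tau> y. order_sign j y) *
      ((\<Prod>i\<in>{0..<\<tau> j}. A i j) * (\<Prod>i\<in>{\<tau> j<..k}. B i j))" if j: "j \<le> k" for j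
  proof -
    have "(\<Prod>i\<in>{0..<k}. ?w i j) = (\<Prod>i\<in>{0..<\<tau> j}. ?w i j) * (\<Prod>i\<in>{\<tau> j..<k}. ?w i j)"
      using bnd[OF j] by (simp add: prod.atLeastLessThan_concat)
    also have "(\<Prod>i\<in>{0..<\<tau> j}. ?w i j) = (\<Prod>i\<in>{0..<\<tau> j}. A i j)"
      using bnd[OF j] j by (intro prod.cong) (auto simp: perm_matching_def black_idx_def edge_weight_def)
    also have "(\<Prod>i\<in>{\<tau> j..<k}. ?w i j) =
        (\<Prod>i\<in>{\<tau> j..<k}. of_int (order_sign j (inv \<tau> (Suc i))) * B (Suc i) j)"
    proof (rule prod.cong)
      fix i assume i: "i \<in> {\<tau> j..<k}"
      have "j \<noteq> inv \<tau> (Suc i)"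
      proof
        assume "j = inv \<tau> (Suc i)"
        then have "\<tau> j = Suc i" using permutes_inverses(1)[OF assms] by metis
        then show False using i by simp
      qed
      then show "?w i j = of_int (order_sign j (inv \<tau> (Suc i))) * B (Suc i) j"
        using i j by (auto simp: perm_matching_def black_idx_def edge_weight_def order_sign_def)
    qed simp
    also have "\<dots> = (\<Prod>i\<in>{\<tau> j<..k}. of_int (order_sign j (inv \<tau> i)) * B i j)"
      by (rule prod.reindex_bij_witness[where i = "\<lambda>i. i - 1" and j = Suc]) auto
    also have "\<dots> = of_int (\<Prod>i\<in>{\<tau> j<..k}. order_sign j (inv \<tau> i)) * (\<Prod>i\<in>{\<tau> j<..k}. B i j)"
      by (simp add: prod.distrib)
    \<comment> \<open>The substitution i = \<tau>(y) replaces columns to the right of \<tau>(j) by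
      the rows that skip them.\<close>
    also have "(\<Prod>i\<in>{\<tau> j<..k}. order_sign j (inv \<tau> i)) =
        (\<Prod>y | y \<in> {0..k} \<and> \<tau> j < \<tau> y. order_sign j y)"
      by (rule prod.reindex_bij_witness[where i = \<tau> and j = "inv \<tau>"])
        (use permutes_in_image[OF permutes_inv[OF assms]] in
          \<open>auto simp: permutes_inverses[OF assms] bnd\<close>)
    finally show ?thesis by (simp add: ac_simps)
  qed
  have "(\<Prod>b\<in>black_idx k. edge_weight A B (perm_matching k \<tau> b) b) = (\<Prod>j=0..k. \<Prod>i\<in>{0..<k}. ?w i j)"
    unfolding black_idx_def by (subst prod.swap) (simp add: prod.cartesian_product case_prod_unfold)
  also have "\<dots> = (\<Prod>j=0..k. of_int (\<Prod>y | y \<in> {0..k} \<and> \<tau> j < \<tau> y. order_sign j y) *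
      ((\<Prod>i\<in>{0..<\<tau> j}. A i j) * (\<Prod>i\<in>{\<tau> j<..k}. B i j)))"
    by (rule prod.cong) (auto simp: row)
  also have "\<dots> = of_int (\<Prod>j=0..k. \<Prod>y | y \<in> {0..k} \<and> \<tau> j < \<tau> y. order_sign j y) *
      (\<Prod>j=0..k. (\<Prod>i\<in>{0..<\<tau> j}. A i j) * (\<Prod>i\<in>{\<tau> j<..k}. B i j))"
    by (simp add: prod.distrib)
  finally show ?thesis using sign_eq_prod_image_order[OF assms] by simp
qed

lemma sum_matching_funs:
  fixes A B :: "nat \<Rightarrow> nat \<Rightarrow> 'a::comm_ring_1"
  shows "(\<Sum>h\<in>matching_funs k. \<Prod>b\<in>black_idx k. edge_weight A B (h b) b) =
    (\<Sum>\<tau> | \<tau> permutes {0..k}. of_int (sign \<tau>) *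
      (\<Prod>j=0..k. (\<Prod>i\<in>{0..<\<tau> j}. A i j) * (\<Prod>i\<in>{\<tau> j<..k}. B i j)))"
  unfolding sum_clash_free clash_free_eq
  by (simp add: sum.reindex inj_perm_matching perm_matching_weight)

section \<open>Gauge equivalence of Kasteleyn orientations\<close>

text \<open>Positive exactly at the lower right corner of a white face. Every quadrilateral then has
  three negative edges, so this is a Kasteleyn orientation, and every edge weight becomes c - d
  except at the upper left corner, where it is d - c.\<close>

definition standard_sign :: "nat \<times> nat \<Rightarrow> nat \<times> nat \<Rightarrow> int" where
  "standard_sign w b = (if w = b then 1 else - 1)"

text \<open>If three edges of a quadrilateral already have gauged standard form, its sign condition
  forces the fourth; s, s' belong to the whites and t, t' to the blacks.\<close>

lemma signs_from_face:
  fixes x s s' t t' :: int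
  assumes "x * (s * t) * (- (s * t')) * (- (s' * t)) = - 1"
    and "s \<in> {1, - 1}" "s' \<in> {1, - 1}" "t \<in> {1, - 1}" "t' \<in> {1, - 1}"
  shows "x = - (s' * t')"
  using assms by auto

text \<open>Divided by \<open>standard_sign\<close>, \<open>e\<close> has product 1 around every
  quadrilateral, so it is trivial on all cycles and splits into vertex signs. The proof builds these
  signs column by column.\<close>

lemma kasteleyn_gauge:
  fixes e :: "nat \<times> nat \<Rightarrow> nat \<times> nat \<Rightarrow> int"
  assumes pm: "\<And>w b. w \<in> white_idx k \<Longrightarrow> b \<in> black_idx k \<Longrightarrow> adj w b \<Longrightarrow> e w b \<in> {1, - 1}"
    and g: "\<And>i j. i < k \<Longrightarrow> j < k \<Longrightarrow>
      e (Suc i, j) (i, j) * e (Suc i, j) (i, Suc j) * e (i, j) (i, j) * e (i, j) (i, Suc j) = - 1"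
    and f: "\<And>i j. Suc i < k \<Longrightarrow> Suc j < k \<Longrightarrow>
      e (Suc i, j) (Suc i, Suc j) * e (Suc i, Suc j) (Suc i, Suc j) *
      e (Suc i, j) (i, Suc j) * e (Suc i, Suc j) (i, Suc j) = - 1"
  obtains s t :: "nat \<times> nat \<Rightarrow> int"
  where "\<And>w. w \<in> white_idx k \<Longrightarrow> s w \<in> {1, - 1}" "\<And>b. b \<in> black_idx k \<Longrightarrow> t b \<in> {1, - 1}"
    "\<And>w b. w \<in> white_idx k \<Longrightarrow> b \<in> black_idx k \<Longrightarrow> adj w b \<Longrightarrow> e w b = s w * t b * standard_sign w b"
proof -
  \<comment> \<open>\<open>T i\<close> fixes the gauge on column \<open>i\<close> of the black vertices, walking up along column 0 and then from
    left to right; the face conditions give the edges not used by this walk.\<close>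
  define t0 where "t0 j = (\<Prod>l<j. - (e (0, l) (0, l) * e (0, l) (0, Suc l)))" for j
  define T where "T = rec_nat t0 (\<lambda>i prev j.
    if j < k then - (prev j * e (Suc i, j) (i, j) * e (Suc i, j) (Suc i, j))
    else prev (j - 1) * e (Suc i, j - 1) (i, j - 1) * e (Suc i, j - 1) (Suc i, j))"
  have T0: "T 0 = t0" and TS: "T (Suc i) j =
    (if j < k then - (T i j * e (Suc i, j) (i, j) * e (Suc i, j) (Suc i, j))
     else T i (j - 1) * e (Suc i, j - 1) (i, j - 1) * e (Suc i, j - 1) (Suc i, j))" for i j
    by (simp_all add: T_def)
  \<comment> \<open>The sign of each white is forced by one edge to an already treated black: the
    lower right one in column 0, the lower left one elsewhere.\<close>
  define S where "S i j =
    (case i of 0 \<Rightarrow> T 0 j * e (0, j) (0, j) | Suc i' \<Rightarrow> - (T i' j * e (Suc i', j) (i', j)))" for i j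
  have LR: "e (i, j) (i, j) \<in> {1, - 1}" and UR: "e (i, j) (i, Suc j) \<in> {1, - 1}"
    and LL: "e (Suc i, j) (i, j) \<in> {1, - 1}" if "i < k" "j < k" for i j
    using that pm[of "(i, j)" "(i, j)"] pm[of "(i, j)" "(i, Suc j)"]
      pm[of "(Suc i, j)" "(i, j)"]
    by (simp_all add: white_idx_def black_idx_def adj_def)
  have T: "T i j \<in> {1, - 1}" if "i < k" "j \<le> k" for i j
    using that
  proof (induction i arbitrary: j)
    case 0
    have "t0 j \<in> {1, - 1}" if "j \<le> k" for j
      using that
    proof (induction j)
      case (Suc j)
      then show ?case using LR[of 0 j] UR[of 0 j] 0 by (auto simp: t0_def)
    qed (simp add: t0_def)
    then show ?case using 0 by (simp add: T0)
  next
    case (Suc i)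
    have "T i j \<in> {1, - 1}" "T i (j - 1) \<in> {1, - 1}" using Suc by auto
    moreover have "k - 1 < k" "Suc (k - 1) = k" using Suc by auto
    ultimately show ?case
      using Suc.prems LR[of "Suc i" j] LL[of i j] UR[of "Suc i" "k - 1"] LL[of i "k - 1"]
      by (cases "j < k") (auto simp: TS)
  qed
  have S: "S i j \<in> {1, - 1}" if "i \<le> k" "j < k" for i j
    using that T[of 0 j] LR[of 0 j] T[of "i - 1" j] LL[of "i - 1" j]
    by (cases i) (auto simp: S_def)
  have right: "e (i, j) (i, j) = S i j * T i j \<and> e (i, j) (i, Suc j) = - (S i j * T i (Suc j)) \<and>
      e (Suc i, j) (i, j) = - (S (Suc i) j * T i j) \<and> e (Suc i, j) (i, Suc j) = - (S (Suc i) j * T i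
          (Suc j))"
    if "i < k" "j < k" for i j
    using that
  proof (induction i arbitrary: j)
    case 0
    have A: "e (0, j) (0, j) = S 0 j * T 0 j"
      using T[of 0 j] 0 by (auto simp: S_def)
    have B: "e (0, j) (0, Suc j) = - (S 0 j * T 0 (Suc j))"
      using T[of 0 j] LR[of 0 j] UR[of 0 j] 0 by (auto simp: S_def T0 t0_def)
    have C: "e (Suc 0, j) (0, j) = - (S (Suc 0) j * T 0 j)"
      using T[of 0 j] 0 by (auto simp: S_def)
    have D: "e (Suc 0, j) (0, Suc j) = - (S (Suc 0) j * T 0 (Suc j))"
    proof (rule signs_from_face)
      show "e (Suc 0, j) (0, Suc j) * (S 0 j * T 0 j) * (- (S 0 j * T 0 (Suc j))) *
          (- (S (Suc 0) j * T 0 j)) = - 1"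
        unfolding A[symmetric] B[symmetric] C[symmetric] using g[of 0 j] 0 by (simp add: ac_simps)
    qed (use S[of 0 j] S[of "Suc 0" j] T[of 0 j] T[of 0 "Suc j"] 0 in simp_all)
    show ?case using A B C D by simp
  next
    case (Suc i)
    let ?i = "Suc i"
    have IH: "e (?i, l) (i, l) = - (S ?i l * T i l)" "e (?i, l) (i, Suc l) = - (S ?i l * T i (Suc l))"
      if "l < k" for l
      using Suc.IH[of l] Suc.prems that by simp_all
    have A: "e (?i, l) (?i, l) = S ?i l * T ?i l" if "l < k" for l
      using IH[OF that] that Suc.prems T[of i l] S[of ?i l] by (auto simp: TS S_def)
    have B: "e (?i, j) (?i, Suc j) = - (S ?i j * T ?i (Suc j))"
    \<comment> \<open>Below the top row the quadrilateral around a horizontal edge decides. The top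
      black has no white at its own height, so \<open>T\<close> was defined there through this very
      edge.\<close>
    proof (cases "Suc j < k")
      case True
      have "e (?i, j) (?i, Suc j) = - (S ?i j * T ?i (Suc j))"
      proof (rule signs_from_face)
        show "e (?i, j) (?i, Suc j) * (S ?i (Suc j) * T i (Suc j)) * (- (S ?i (Suc j) * T ?i (Suc j))) *
            (- (S ?i j * T i (Suc j))) = - 1"
          using f[of i j] A[OF True] IH(2)[OF Suc.prems(2)] IH(1)[OF True] True Suc.prems
          by (simp add: ac_simps)
      qed (use S[of ?i j] S[of ?i "Suc j"] T[of i "Suc j"] T[of ?i "Suc j"] True Suc.prems in simp_all)
      then show ?thesis .
    next
      case False
      then have "Suc j = k" using Suc.prems by simp
      then show ?thesis
        using IH[of j] Suc.prems S[of ?i j] T[of i j] UR[of ?i j] by (auto simp: TS)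
    qed
    have C: "e (Suc ?i, j) (?i, j) = - (S (Suc ?i) j * T ?i j)"
      using T[of ?i j] Suc.prems by (auto simp: S_def)
    have D: "e (Suc ?i, j) (?i, Suc j) = - (S (Suc ?i) j * T ?i (Suc j))"
    proof (rule signs_from_face)
      show "e (Suc ?i, j) (?i, Suc j) * (S ?i j * T ?i j) * (- (S ?i j * T ?i (Suc j))) *
          (- (S (Suc ?i) j * T ?i j)) = - 1"
        unfolding A[OF Suc.prems(2), symmetric] B[symmetric] C[symmetric]
        using g[of ?i j] Suc.prems by (simp add: ac_simps)
    qed (use S[of ?i j] S[of "Suc ?i" j] T[of ?i j] T[of ?i "Suc j"] Suc.prems in simp_all)
    show ?case using A[of j] B C D Suc.prems by simp
  qed
  show thesis
  proof (rule that[of "\<lambda>(i, j). S i j" "\<lambda>(i, j). T i j"])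
    fix w b assume wb: "w \<in> white_idx k" "b \<in> black_idx k" "adj w b"
    obtain i j p q where [simp]: "w = (i, j)" "b = (p, q)" by force
    have "p < k" "j < k" "p = i \<or> Suc p = i" "q = j \<or> q = Suc j"
      using wb by (auto simp: white_idx_def black_idx_def adj_def)
    then show "e w b = (case w of (i, j) \<Rightarrow> S i j) * (case b of (i, j) \<Rightarrow> T i j) * standard_sign w b"
      using right[of p j] by (auto simp: standard_sign_def)
  next
    show "(case w of (i, j) \<Rightarrow> S i j) \<in> {1, - 1}" if "w \<in> white_idx k" for w
      using that S by (cases w) (simp add: white_idx_def)
    show "(case b of (i, j) \<Rightarrow> T i j) \<in> {1, - 1}" if "b \<in> black_idx k" for b
      using that T by (cases b) (simp add: black_idx_def)
  qed
qed

section \<open>Matchings as functions, and the evaluation of \<open>Z\<close>\<close>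

definition graph_of_matching :: "nat \<Rightarrow> (nat \<times> nat \<Rightarrow> nat \<times> nat) \<Rightarrow> (gface \<times> vert) set" where
  "graph_of_matching k h = (\<lambda>b. (face k (h b), blk b)) ` black_idx k"

text \<open>Uniqueness of the partner at each black yields the function; existence and uniqueness at
  each white are its surjectivity and injectivity.\<close>

lemma bij_betw_matchings:
  assumes "0 < k"
  shows "bij_betw (graph_of_matching k) (matching_funs k) (aztec_perfect_matchings k)"
  unfolding bij_betw_def
proof
  have blk_eq: "blk b = blk b' \<longleftrightarrow> b = b'" for b b' using inj_blk by (simp add: inj_eq)
  have face_eq: "face k w = face k w' \<longleftrightarrow> w = w'" if "w \<in> white_idx k" "w' \<in> white_idx k" for w w'
    using inj_on_eq_iff[OF inj_face[OF assms] that] .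
  show "inj_on (graph_of_matching k) (matching_funs k)"
  proof (rule inj_onI)
    fix h h' assume h: "h \<in> matching_funs k" "h' \<in> matching_funs k"
      and eq: "graph_of_matching k h = graph_of_matching k h'"
    have "h b = h' b" if b: "b \<in> black_idx k" for b
    proof -
      have "(face k (h b), blk b) \<in> graph_of_matching k h'"
        unfolding eq[symmetric] unfolding graph_of_matching_def using b by (rule imageI)
      then obtain b' where "face k (h b) = face k (h' b')" "blk b = blk b'"
        unfolding graph_of_matching_def by blast
      then have "face k (h b) = face k (h' b)" unfolding blk_eq by simp
      moreover have "h b \<in> white_idx k" "h' b \<in> white_idx k"
        using matching_funs_white h b by blast+
      ultimately show ?thesis using face_eq by blast
    qed
    then show "h = h'" using h by (auto simp: matching_funs_def intro: extensionalityI)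
  qed
  show "graph_of_matching k ` matching_funs k = aztec_perfect_matchings k"
  proof (intro equalityI subsetI)
    fix M assume "M \<in> graph_of_matching k ` matching_funs k"
    then obtain h where h: "bij_betw h (black_idx k) (white_idx k)" "\<forall>b\<in>black_idx k. adj (h b) b"
      and M: "M = graph_of_matching k h" by (auto simp: matching_funs_def)
    have hw: "h b \<in> white_idx k" if "b \<in> black_idx k" for b
      by (rule bij_betw_apply[OF h(1) that])
    have in_M: "(face k w, v) \<in> M \<longleftrightarrow> (\<exists>b\<in>black_idx k. h b = w \<and> v = blk b)" if "w \<in> white_idx k" for w v
      unfolding M graph_of_matching_def image_iff prod.inject using face_eq[OF that hw] by metis
    have "M \<subseteq> aztec_edges k"
    proof
      fix p assume "p \<in> M"
      then obtain b where b: "b \<in> black_idx k" "p = (face k (h b), blk b)"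
        unfolding M graph_of_matching_def by (rule imageE)
      show "p \<in> aztec_edges k"
        unfolding aztec_edges_eq[OF assms] mem_Collect_eq
        using hw[OF b(1)] b bspec[OF h(2) b(1)] by (intro exI[of _ "h b"] exI[of _ b]) simp
    qed
    moreover have "\<exists>!b. (face k w, b) \<in> M" if w: "w \<in> white_idx k" for w
    proof -
      obtain b where b: "b \<in> black_idx k" "h b = w"
        using w[folded bij_betw_imp_surj_on[OF h(1)]] by (elim imageE) simp
      show ?thesis
      proof (rule ex1I)
        show "(face k w, blk b) \<in> M" unfolding in_M[OF w] using b by blast
        fix v assume "(face k w, v) \<in> M"
        then obtain b' where b': "b' \<in> black_idx k" "h b' = w" "v = blk b'" unfolding in_M[OF w] by blast
        have "b' = b"
          using inj_onD[OF bij_betw_imp_inj_on[OF h(1)] _ b'(1) b(1)] b(2) b'(2) by simp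
        then show "v = blk b" using b'(3) by simp
      qed
    qed
    moreover have "\<exists>!w. (w, blk b) \<in> M" if "b \<in> black_idx k" for b
      unfolding M graph_of_matching_def image_iff prod.inject blk_eq using that by (intro ex1I[of _
          "face k (h b)"]) auto
    ultimately show "M \<in> aztec_perfect_matchings k"
      by (simp add: aztec_perfect_matchings_def white_faces_eq[OF assms] black_verts_eq)
  next
    fix M assume "M \<in> aztec_perfect_matchings k"
    then have sub: "M \<subseteq> aztec_edges k"
      and white: "\<And>w. w \<in> white_idx k \<Longrightarrow> \<exists>!v. (face k w, v) \<in> M"
      and black: "\<And>b. b \<in> black_idx k \<Longrightarrow> \<exists>!f. (f, blk b) \<in> M"
      by (simp_all add: aztec_perfect_matchings_def white_faces_eq[OF assms] black_verts_eq)
    have edge: "\<exists>w b. p = (face k w, blk b) \<and> w \<in> white_idx k \<and> b \<in> black_idx k \<and> adj w b" if "p \<in> M" for p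
      using sub that unfolding aztec_edges_eq[OF assms] by blast
    have "\<exists>w. w \<in> white_idx k \<and> adj w b \<and> (face k w, blk b) \<in> M" if "b \<in> black_idx k" for b
      using black[OF that] edge blk_eq by (metis prod.inject)
    then obtain h where h: "\<And>b. b \<in> black_idx k \<Longrightarrow> h b \<in> white_idx k \<and> adj (h b) b \<and> (face k (h b),
        blk b) \<in> M"
      by metis
    have "inj_on h (black_idx k)"
      using h white blk_eq by (intro inj_onI) metis
    moreover have "w \<in> h ` black_idx k" if w: "w \<in> white_idx k" for w
    proof -
      obtain b where b: "b \<in> black_idx k" "(face k w, blk b) \<in> M"
        using white[OF w] edge by (metis prod.inject)
      then have "face k w = face k (h b)" using h black by blast
      then show ?thesis using face_eq[OF w] h b by blast
    qed
    ultimately have "bij_betw h (black_idx k) (white_idx k)" using h by (auto simp: bij_betw_def)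
    then have "restrict h (black_idx k) \<in> matching_funs k"
      using h by (simp add: matching_funs_def cong: bij_betw_cong)
    moreover have "M = graph_of_matching k (restrict h (black_idx k))"
    proof -
      have graph: "graph_of_matching k (restrict h (black_idx k)) = (\<lambda>b. (face k (h b), blk b)) `
          black_idx k"
        unfolding graph_of_matching_def by (rule image_cong) simp_all
      have "p \<in> (\<lambda>b. (face k (h b), blk b)) ` black_idx k" if p: "p \<in> M" for p
      proof -
        obtain w b where b: "p = (face k w, blk b)" "b \<in> black_idx k" using edge[OF p] by blast
        then have "p = (face k (h b), blk b)" using p h[OF b(2)] black[OF b(2)] by blast
        then show ?thesis using b(2) by (rule image_eqI)
      qed
      moreover have "p \<in> M" if "p \<in> (\<lambda>b. (face k (h b), blk b)) ` black_idx k" for p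
        using that h by (elim imageE) simp
      ultimately show ?thesis unfolding graph by blast
    qed
    ultimately show "M \<in> graph_of_matching k ` matching_funs k" by blast
  qed
qed

lemma aztec_Z_matching_funs:
  assumes "0 < k"
  shows "aztec_Z k a \<phi> = (\<Sum>h\<in>matching_funs k. \<Prod>b\<in>black_idx k. of_int (edge_sign k \<phi> (h b) b) *
    (a (edge_before (face k (h b)) (blk b)) - a (edge_after (face k (h b)) (blk b))))"
proof -
  have "inj_on (\<lambda>b. (face k (h b), blk b)) (black_idx k)" for h
    by (rule inj_onI) (simp add: inj_eq[OF inj_blk])
  note reindex = prod.reindex[OF this]
  show ?thesis
    unfolding aztec_Z_def sum.reindex_bij_betw[OF bij_betw_matchings[OF assms], symmetric]
      graph_of_matching_def edge_sign_def by (simp only: reindex o_def prod.case)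
qed

text \<open>At the upper right and lower left corners the vertical edge comes first, so the raw
  weight d - c meets a negative standard sign; at the upper left corner c - d meets one.\<close>

lemma corner_weight:
  fixes a :: "vert set \<Rightarrow> 'a::comm_ring_1"
  assumes "0 < k" "w \<in> white_idx k" "b \<in> black_idx k" "adj w b"
    and c: "\<And>i j. i \<le> k \<Longrightarrow> j \<le> k \<Longrightarrow> a (e_edge k i j) = c i j"
    and d: "\<And>i j. i < k \<Longrightarrow> j < k \<Longrightarrow> a (g_edge i j) = \<delta> i"
  shows "of_int (standard_sign w b) * (a (edge_before (face k w) (blk b)) - a (edge_after (face k w)
      (blk b))) =
    edge_weight (\<lambda>i j. c i j - \<delta> i) (\<lambda>i j. c i j - \<delta> (i - 1)) w b"
proof -
  obtain i j p q where wb: "w = (i, j)" "b = (p, q)" by force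
  have ij: "i \<le> k" "j < k" "p < k" "q \<le> k" using assms by (auto simp: wb white_idx_def black_idx_def)
  note around = edges_around_corner[OF assms(1) ij(1,2)]
  consider "p = i" "q = j" | "p = i" "q = Suc j" | "i = Suc p" "q = Suc j" | "i = Suc p" "q = j"
    using assms(4) by (auto simp: wb adj_def)
  then show ?thesis
    using ij around by cases (simp_all add: wb blk_def standard_sign_def edge_weight_def c d)
qed

theorem theorem5p6:
  fixes k :: nat
    and a :: "vert set \<Rightarrow> 'a::comm_ring_1"
    and c d :: "nat \<Rightarrow> nat \<Rightarrow> 'a" and \<delta> :: "nat \<Rightarrow> 'a"
    and \<phi> :: "aztec_vert \<times> aztec_vert \<Rightarrow> int"
  assumes "k \<ge> 1"
    and "\<And>i j. i \<le> k \<Longrightarrow> j \<le> k \<Longrightarrow> a (e_edge k i j) = c i j"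
    and "\<And>i j. i < k \<Longrightarrow> j < k \<Longrightarrow> a (g_edge i j) = d i j"
    and "\<And>i j. i < k \<Longrightarrow> j < k \<Longrightarrow> d i j = \<delta> i"
    and "kasteleyn_orientation k \<phi>"
  shows "\<exists>s\<in>{1, -1 :: int}. aztec_Z k a \<phi> = of_int s *
    (\<Sum>\<tau> | \<tau> permutes {0..k}. of_int (sign \<tau>) *
      (\<Prod>j=0..k. (\<Prod>i\<in>{0..<\<tau> j}. c i j - \<delta> i) * (\<Prod>i\<in>{\<tau> j<..k}. c i j - \<delta> (i - 1))))"
proof -
  have k: "0 < k" using assms(1) by simp
  \<comment> \<open>The truncated \<open>i - 1\<close> is harmless: the second product runs over i >
    \<tau>(j), so i = 0 never occurs there.\<close>
  let ?A = "\<lambda>i j. c i j - \<delta> i" and ?B = "\<lambda>i j. c i j - \<delta> (i - 1)"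
  obtain s t :: "nat \<times> nat \<Rightarrow> int"
    where s: "\<And>w. w \<in> white_idx k \<Longrightarrow> s w \<in> {1, - 1}" and t: "\<And>b. b \<in> black_idx k \<Longrightarrow> t b \<in> {1, - 1}"
      and gauge: "\<And>w b. w \<in> white_idx k \<Longrightarrow> b \<in> black_idx k \<Longrightarrow> adj w b \<Longrightarrow>
        edge_sign k \<phi> w b = s w * t b * standard_sign w b"
    using kasteleyn_gauge[of k "edge_sign k \<phi>"] kasteleyn_edge_sign[OF assms(5)] by blast
  \<comment> \<open>A perfect matching covers each vertex exactly once, so the gauge signs along it
    multiply to this same number for every matching.\<close>
  define u where "u = (\<Prod>w\<in>white_idx k. s w) * (\<Prod>b\<in>black_idx k. t b)"
  have unit: "prod f X \<in> {1, - 1 :: int}" if "finite X" "\<And>x. x \<in> X \<Longrightarrow> f x \<in> {1, - 1}"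
    for f and X :: "(nat \<times> nat) set"
    using that
  proof (induction X rule: finite_induct)
    case (insert x X)
    then have "f x \<in> {1, - 1}" "prod f X \<in> {1, - 1}" by blast+
    then show ?case using insert(1,2) by auto
  qed simp
  have "u \<in> {1, - 1}"
    using unit[of "white_idx k" s] unit[of "black_idx k" t] s t finite_idx by (auto simp: u_def)
  have "(\<Prod>b\<in>black_idx k. of_int (edge_sign k \<phi> (h b) b) *
      (a (edge_before (face k (h b)) (blk b)) - a (edge_after (face k (h b)) (blk b)))) =
      of_int u * (\<Prod>b\<in>black_idx k. edge_weight ?A ?B (h b) b)" if h: "h \<in> matching_funs k" for h
  proof -
    have hb: "h b \<in> white_idx k" "adj (h b) b" if "b \<in> black_idx k" for b
      using matching_funs_white[OF h that] h that by (simp_all add: matching_funs_def)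
    have "(\<Prod>b\<in>black_idx k. of_int (edge_sign k \<phi> (h b) b) *
      (a (edge_before (face k (h b)) (blk b)) - a (edge_after (face k (h b)) (blk b)))) =
      (\<Prod>b\<in>black_idx k. of_int (s (h b)) * of_int (t b) * edge_weight ?A ?B (h b) b)"
    proof (rule prod.cong)
      fix b assume b: "b \<in> black_idx k"
      show "of_int (edge_sign k \<phi> (h b) b) *
          (a (edge_before (face k (h b)) (blk b)) - a (edge_after (face k (h b)) (blk b))) =
        of_int (s (h b)) * of_int (t b) * edge_weight ?A ?B (h b) b"
        using corner_weight[OF k hb(1)[OF b] b hb(2)[OF b], of a c \<delta>] assms(2-4) gauge[OF hb(1)[OF b] b hb(2)[OF b]]
        by (simp add: mult.assoc)
    qed simp
    also have "\<dots> = of_int ((\<Prod>b\<in>black_idx k. s (h b)) * (\<Prod>b\<in>black_idx k. t b)) *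
        (\<Prod>b\<in>black_idx k. edge_weight ?A ?B (h b) b)"
      by (simp add: prod.distrib)
    also have "(\<Prod>b\<in>black_idx k. s (h b)) = (\<Prod>w\<in>white_idx k. s w)"
      using h by (intro prod.reindex_bij_betw) (simp add: matching_funs_def)
    finally show ?thesis by (simp add: u_def)
  qed
  then have "aztec_Z k a \<phi> = of_int u * (\<Sum>h\<in>matching_funs k. \<Prod>b\<in>black_idx k. edge_weight ?A ?B (h b) b)"
    unfolding aztec_Z_matching_funs[OF k] by (simp add: sum_distrib_left)
  then show ?thesis
    unfolding sum_matching_funs using \<open>u \<in> {1, - 1}\<close> by blast
qed

end
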